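(* Let $n\geq 1$ be an integer. Then $$\int_0^1\frac{x^{2n-1}}{\operatorname{arctanh}x}\,dx=\sum_{p=1}^{n}\left(2^{2p+1}-1\right)\Bigl([z^{2n}](z^2-1)^{n-1}(\arcsin z)^{2p}\Bigr)\frac{\zeta(2p+1)}{\pi^{2p}},$$ and $$\int_0^1\frac{x^{2n-1}}{\sqrt{1-x^2}\,\operatorname{arctanh}x}\,dx=\sum_{p=1}^{n}2^{2p}\,\Bigl([z^{2n-1}](z^2-1)^{n-1}(\arcsin z)^{2p-1}\Bigr)\frac{\beta(2p)}{\pi^{2p-1}}.$$
   Context: $\zeta$ is the Riemann zeta function and $\beta$ is the Dirichlet beta function, $\beta(s)=\sum_{r\ge0}(-1)^r(2r+1)^{-s}$. $[z^r]F(z)$ denotes the coefficient of $z^r$ in the expansion of $F$ at the origin; $\arcsin$ is the principal branch. *)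

theory Defs
  imports "HOL-Complex_Analysis.Complex_Analysis"
begin

text \<open>
  The Riemann zeta function on the half-plane \<open>Re s > 1\<close>, where it is given by its Dirichlet
  series.  The analytic continuation is not needed: it is only evaluated at odd integers
  \<open>\<ge> 3\<close>.  Outside that half-plane the value below carries no meaning.
\<close>
definition zeta :: "complex \<Rightarrow> complex" where
  "zeta s = (\<Sum>k. of_nat (Suc k) powr (- s))"

text \<open>The series converges (and equals the Dirichlet beta function) for \<open>Re s > 0\<close>.\<close>
definition dirichlet_beta :: "complex \<Rightarrow> complex" where
  "dirichlet_beta s = (\<Sum>r. (- 1) ^ r * of_nat (2 * r + 1) powr (- s))"

end

theory Submission
  imports Defs
begin

text \<open>
  Substituting \<open>x = tanh t\<close> and expanding \<open>(tanh t)\<^sup>2 = 1 - sech\<^sup>2 t\<close> by the binomial theorem reduces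
  both integrals to integrals of \<open>tanh t * sech\<^sup>k t / t\<close> over \<open>t > 0\<close>, with \<open>k\<close> even in the first and odd
  in the second case.  Differentiating twice,
  \<open>(tanh * sech\<^sup>k)'' = k\<^sup>2 * tanh * sech\<^sup>k - (k + 1) * (k + 2) * tanh * sech\<^bsup>k+2\<^esup>\<close>, which is the recurrence
  that the differential equation \<open>(1 - z\<^sup>2) q'' - z q' = j (j - 1) arcsin\<^bsup>j-2\<^esup> z\<close> of \<open>q = arcsin\<^sup>j z\<close> imposes
  on Taylor coefficients.  Hence \<open>tanh * sech\<^sup>k\<close> is the combination, with the coefficients of \<open>z\<^sup>k\<close> in the powers
  \<open>arcsin\<^sup>j z\<close>, of the normalised derivatives of order \<open>j\<close> of \<open>tanh\<close> (\<open>j\<close> even) and \<open>sech\<close> (\<open>j\<close> odd).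
  The partial fraction expansions of the latter have poles \<open>\<plusminus>\<i>a\<close> with \<open>a = (2 l + 1) \<pi> / 2\<close>, and since
  \<open>\<integral> ((a - \<i>t)\<^bsup>-m\<^esup> - (a + \<i>t)\<^bsup>-m\<^esup>) / t dt = \<i> \<pi> / a\<^sup>m\<close> over \<open>t > 0\<close>, integrating them termwise against
  \<open>1 / t\<close> gives the zeta and beta values.
\<close>

section \<open>Taylor coefficients of powers of the arcsine\<close>

definition arcsin_coeff :: "nat \<Rightarrow> nat \<Rightarrow> complex" where
  "arcsin_coeff j k = fps_nth (fps_expansion Arcsin 0 ^ j) k"

lemma has_fps_expansion_Arcsin: "Arcsin has_fps_expansion fps_expansion Arcsin 0"
  by (rule has_fps_expansion_fps_expansion[of "ball 0 1"])
     (auto intro!: holomorphic_on_Arcsin intro: le_less_trans[OF abs_Re_le_cmod])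

lemma fps_Arcsin_nth_0: "fps_nth (fps_expansion Arcsin 0) 0 = 0"
  by (simp add: fps_expansion_def)

lemma fps_Arcsin_nth_1: "fps_nth (fps_expansion Arcsin 0) 1 = 1"
proof -
  have "(Arcsin has_field_derivative inverse (cos (Arcsin 0))) (at 0)"
    by (rule has_field_derivative_Arcsin) simp
  then show ?thesis
    by (simp add: fps_expansion_def DERIV_imp_deriv)
qed

text \<open>The derivative of \<open>Arcsin\<close> is \<open>1 / cos (Arcsin z)\<close>, and
  \<open>cos\<^sup>2 = 1 - sin\<^sup>2\<close>. Squaring keeps the identity free of square roots, so
  it transfers from the unit disc to power series by uniqueness of expansions.\<close>

lemma fps_deriv_Arcsin_square:
  "(1 - fps_X\<^sup>2) * (fps_deriv (fps_expansion Arcsin 0))\<^sup>2 = 1"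
proof (rule fps_expansion_unique_complex)
  show "(\<lambda>z. (1 - z\<^sup>2) * (deriv Arcsin z)\<^sup>2) has_fps_expansion
          (1 - fps_X\<^sup>2) * (fps_deriv (fps_expansion Arcsin 0))\<^sup>2"
    by (intro fps_expansion_intros has_fps_expansion_Arcsin)
  have "(1 - z\<^sup>2) * (deriv Arcsin z)\<^sup>2 = 1" if "z \<in> ball 0 1" for z :: complex
  proof -
    have z: "\<bar>Re z\<bar> < 1"
      using that abs_Re_le_cmod[of z] by simp
    then have "deriv Arcsin z = inverse (cos (Arcsin z))"
      by (intro DERIV_imp_deriv has_field_derivative_Arcsin)
    moreover have "(cos (Arcsin z))\<^sup>2 = 1 - z\<^sup>2"
      using sin_cos_squared_add[of "Arcsin z"] by (simp add: algebra_simps)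
    moreover have "z\<^sup>2 \<noteq> 1"
    proof
      assume "z\<^sup>2 = 1"
      then have "norm z ^ 2 = 1" by (metis norm_one norm_power)
      then have "norm z = 1" by (metis norm_ge_zero power_one power2_eq_imp_eq zero_le_one)
      then show False using that by simp
    qed
    ultimately show ?thesis
      by (simp add: power_inverse)
  qed
  then have "eventually (\<lambda>z. (1 - z\<^sup>2) * (deriv Arcsin z)\<^sup>2 = 1) (nhds 0)"
    using eventually_nhds_in_open[of "ball 0 1" "0 :: complex"] by (auto elim: eventually_mono)
  then show "(\<lambda>z. (1 - z\<^sup>2) * (deriv Arcsin z)\<^sup>2) has_fps_expansion 1"
    using has_fps_expansion_cong[of "\<lambda>z. (1 - z\<^sup>2) * (deriv Arcsin z)\<^sup>2" "\<lambda>_. 1" 1 1]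
    by simp
qed

text \<open>Differentiating the hypothesis gives \<open>2 * B\<close> times
  \<open>(1 - X\<^sup>2) * B' - X * B\<close>, where \<open>B\<close> is the derivative of
  \<open>A\<close>; power series form an integral domain, so \<open>B\<close> cancels. The rest is
  the product rule for \<open>A ^ j\<close>.\<close>

lemma arcsin_power_ode:
  fixes A :: "'a :: field_char_0 fps"
  assumes "(1 - fps_X\<^sup>2) * (fps_deriv A)\<^sup>2 = 1"
  shows "(1 - fps_X\<^sup>2) * fps_deriv (fps_deriv (A ^ j)) - fps_X * fps_deriv (A ^ j) =
           of_nat (j * (j - 1)) * A ^ (j - 2)"
proof -
  define B where "B = fps_deriv A"
  have B2: "(1 - fps_X\<^sup>2) * B\<^sup>2 = 1"
    using assms by (simp add: B_def)
  then have "B \<noteq> 0" by auto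
  have "fps_deriv ((1 - fps_X\<^sup>2) * B\<^sup>2) = 0"
    using B2 by simp
  then have "(2 * B) * ((1 - fps_X\<^sup>2) * fps_deriv B - fps_X * B) = 0"
    by (simp add: power2_eq_square algebra_simps)
  then have B': "(1 - fps_X\<^sup>2) * fps_deriv B - fps_X * B = 0"
    using \<open>B \<noteq> 0\<close> by simp
  have pow: "fps_deriv (A ^ m) = of_nat m * (B * A ^ (m - 1))" for m
    by (simp add: fps_deriv_power B_def fps_of_nat mult.assoc)
  have "fps_deriv (fps_deriv (A ^ j)) =
          of_nat j * (fps_deriv B * A ^ (j - 1) + B * fps_deriv (A ^ (j - 1)))"
    by (subst pow[of j]) (simp add: algebra_simps)
  also have "\<dots> =
          of_nat j * fps_deriv B * A ^ (j - 1) + of_nat (j * (j - 1)) * B\<^sup>2 * A ^ (j - 2)"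
    unfolding pow[of "j - 1"]
    by (cases j) (simp_all add: algebra_simps power2_eq_square numeral_2_eq_2)
  finally have deriv2: "fps_deriv (fps_deriv (A ^ j)) =
          of_nat j * fps_deriv B * A ^ (j - 1) + of_nat (j * (j - 1)) * B\<^sup>2 * A ^ (j - 2)" .
  have "(1 - fps_X\<^sup>2) * fps_deriv (fps_deriv (A ^ j)) - fps_X * fps_deriv (A ^ j) =
      of_nat j * A ^ (j - 1) * ((1 - fps_X\<^sup>2) * fps_deriv B - fps_X * B)
      + of_nat (j * (j - 1)) * A ^ (j - 2) * ((1 - fps_X\<^sup>2) * B\<^sup>2)"
    unfolding deriv2 unfolding pow[of j] by (simp add: algebra_simps)
  then show ?thesis
    by (simp only: B' B2) simp
qed

text \<open>Coefficient \<open>k\<close> of the differential equation: the parts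
  \<open>k * (k - 1)\<close> from the second derivative and \<open>k\<close> from the first add up
  to \<open>k\<^sup>2\<close>. For \<open>j < 2\<close> the truncated index \<open>j - 2\<close> is
  harmless, since \<open>j * (j - 1) = 0\<close>.\<close>

lemma arcsin_coeff_rec:
  "of_nat ((k + 1) * (k + 2)) * arcsin_coeff j (k + 2) =
     of_nat (k\<^sup>2) * arcsin_coeff j k + of_nat (j * (j - 1)) * arcsin_coeff (j - 2) k"
proof -
  let ?Q = "fps_expansion Arcsin 0 ^ j"
  have "fps_nth ((1 - fps_X\<^sup>2) * fps_deriv (fps_deriv ?Q) - fps_X * fps_deriv ?Q) k =
      fps_nth (of_nat (j * (j - 1)) * fps_expansion Arcsin 0 ^ (j - 2)) k"
    by (simp only: arcsin_power_ode[OF fps_deriv_Arcsin_square])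
  also have "\<dots> = of_nat (j * (j - 1)) * arcsin_coeff (j - 2) k"
    by (simp only: arcsin_coeff_def fps_of_nat[symmetric] fps_mult_left_const_nth)
  also have "fps_nth ((1 - fps_X\<^sup>2) * fps_deriv (fps_deriv ?Q) - fps_X * fps_deriv ?Q) k =
      of_nat ((k + 1) * (k + 2)) * arcsin_coeff j (k + 2) - of_nat (k\<^sup>2) * arcsin_coeff j k"
    by (cases k; cases "k - 1")
       (auto simp: arcsin_coeff_def left_diff_distrib fps_X_power_mult_nth fps_deriv_nth
             numeral_2_eq_2 algebra_simps power2_eq_square)
  finally show ?thesis
    by (simp add: algebra_simps)
qed

lemma arcsin_coeff_0: "arcsin_coeff 0 k = (if k = 0 then 1 else 0)"
  by (simp add: arcsin_coeff_def)

lemma arcsin_coeff_1_1: "arcsin_coeff (Suc 0) (Suc 0) = 1"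
  using fps_Arcsin_nth_1 by (simp add: arcsin_coeff_def)

lemma arcsin_coeff_eq_0:
  assumes "k < j"
  shows "arcsin_coeff j k = 0"
  using startsby_zero_power_prefix[OF fps_Arcsin_nth_0, of j] assms
  by (simp add: arcsin_coeff_def)

text \<open>In the binomial expansion, \<open>m\<close> counts the factors \<open>-1\<close>; the
  remaining \<open>fps_X ^ (2 * (N - m))\<close> lowers the index from \<open>2 * N + s\<close> to
  \<open>2 * m + s\<close>.\<close>

lemma fps_nth_X2_minus_1_power_mult:
  fixes F :: "complex fps"
  assumes "k = 2 * N + s"
  shows "fps_nth ((fps_X\<^sup>2 - 1) ^ N * F) k =
           (\<Sum>m\<le>N. of_nat (N choose m) * (-1) ^ m * fps_nth F (2 * m + s))"
proof -
  have "(fps_X\<^sup>2 - 1 :: complex fps) ^ N = (- 1 + fps_X\<^sup>2) ^ N"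
    by simp
  also have "\<dots> = (\<Sum>m\<le>N. of_nat (N choose m) * (- 1) ^ m * fps_X ^ (2 * (N - m)))"
    by (subst binomial_ring) (simp add: power_mult)
  also have "\<dots> = (\<Sum>m\<le>N. fps_const (of_nat (N choose m) * (- 1) ^ m) * fps_X ^ (2 * (N - m)))"
    by (intro sum.cong) (simp_all add: fps_of_nat[symmetric] fps_const_neg[symmetric]
          fps_const_power[symmetric] fps_const_mult[symmetric] del: fps_const_neg fps_const_power fps_const_mult)
  finally have "fps_nth ((fps_X\<^sup>2 - 1) ^ N * F) k =
      (\<Sum>m\<le>N. of_nat (N choose m) * (-1) ^ m * fps_nth (fps_X ^ (2 * (N - m)) * F) k)"
    by (simp add: sum_distrib_right fps_sum_nth mult.assoc fps_mult_left_const_nth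
        del: fps_const_mult fps_const_power fps_const_neg)
  also have "\<dots> = (\<Sum>m\<le>N. of_nat (N choose m) * (-1) ^ m * fps_nth F (2 * m + s))"
    using assms by (intro sum.cong refl) (auto simp: fps_X_power_mult_nth intro!: arg_cong[of _ _ "fps_nth F"])
  finally show ?thesis .
qed

lemma fps_nth_expansion_X2_minus_1_power_Arcsin_power:
  assumes "k = 2 * N + s"
  shows "fps_nth (fps_expansion (\<lambda>z. (z\<^sup>2 - 1) ^ N * Arcsin z ^ j) 0) k =
           (\<Sum>m\<le>N. of_nat (N choose m) * (-1) ^ m * arcsin_coeff j (2 * m + s))"
proof -
  have "fps_expansion (\<lambda>z. (z\<^sup>2 - 1) ^ N * Arcsin z ^ j) 0 =
          (fps_X\<^sup>2 - 1) ^ N * fps_expansion Arcsin 0 ^ j"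
    by (intro fps_expansion_eqI fps_expansion_intros has_fps_expansion_Arcsin)
  then show ?thesis
    by (simp add: fps_nth_X2_minus_1_power_mult[OF assms] arcsin_coeff_def)
qed

section \<open>Hyperbolic functions as polygamma combinations\<close>

text \<open>The zeros of \<open>cosh\<close> nearest to the real axis are at distance
  \<open>pi / 2\<close>. Working on an open set around the axis allows identities to be
  differentiated.\<close>

definition strip :: "complex set" where
  "strip = {z. \<bar>Im z\<bar> < pi / 2}"

lemma open_strip: "open strip"
  unfolding strip_def by (intro open_Collect_less continuous_intros)

lemma cosh_nonzero_strip:
  assumes "z \<in> strip"
  shows "cosh z \<noteq> 0"
proof
  assume "cosh z = 0"
  then have "cos (\<i> * z) = 0"
    by (simp add: cosh_conv_cos)
  then obtain n :: int where "\<i> * z = of_int n * of_real pi + of_real pi / 2"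
    by (auto simp: cos_eq_0)
  then have "Re (\<i> * z) = Re (of_int n * of_real pi + of_real pi / 2)" by simp
  then have "- Im z = of_int n * pi + pi / 2" by simp
  \<comment> \<open>The bound on \<open>Im z\<close> forces the integer \<open>n\<close> strictly
    between -1 and 0.\<close>
  with assms have "0 < (of_int n + 1) * pi" "of_int n * pi < 0"
    by (auto simp: strip_def algebra_simps abs_less_iff)
  then have "0 < n + 1" "n < 0"
    by (simp_all add: zero_less_mult_iff mult_less_0_iff del: of_int_add)
  then show False by simp
qed

section \<open>Derivatives of tanh times powers of sech\<close>

lemma has_field_derivative_sech_power:
  assumes "z \<in> strip"
  shows "((\<lambda>z. inverse (cosh z) ^ k) has_field_derivative
            - of_nat k * (tanh z * inverse (cosh z) ^ k)) (at z)"
proof -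
  have "((\<lambda>z. inverse (cosh z)) has_field_derivative - (tanh z * inverse (cosh z))) (at z)"
    using cosh_nonzero_strip[OF assms]
    by (auto intro!: derivative_eq_intros simp: tanh_def field_simps power2_eq_square)
  from DERIV_power[OF this, of k] show ?thesis
    by (cases k) (simp_all add: algebra_simps)
qed

lemma tanh_square_strip:
  assumes "z \<in> strip"
  shows "(tanh z)\<^sup>2 = 1 - (inverse (cosh z))\<^sup>2"
proof -
  have "(sinh z)\<^sup>2 = (cosh z)\<^sup>2 - 1"
    by (simp add: cosh_square_eq)
  then show ?thesis
    using cosh_nonzero_strip[OF assms]
    by (simp add: tanh_def power_divide power_inverse inverse_eq_divide diff_divide_distrib)
qed

lemma has_field_derivative_tanh_sech_power:
  assumes "z \<in> strip"
  shows "((\<lambda>z. tanh z * inverse (cosh z) ^ k) has_field_derivative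
            of_nat (k + 1) * inverse (cosh z) ^ (k + 2) - of_nat k * inverse (cosh z) ^ k) (at z)"
proof -
  have tanh': "(tanh has_field_derivative 1 - (tanh z)\<^sup>2) (at z)"
    using cosh_nonzero_strip[OF assms] by (auto intro!: derivative_eq_intros)
  have "((\<lambda>z. tanh z * inverse (cosh z) ^ k) has_field_derivative
      (1 - (tanh z)\<^sup>2) * inverse (cosh z) ^ k
        + tanh z * (- of_nat k * (tanh z * inverse (cosh z) ^ k))) (at z)"
    using DERIV_mult[OF tanh' has_field_derivative_sech_power[OF assms, of k]]
    by (simp add: algebra_simps)
  also have "(1 - (tanh z)\<^sup>2) * inverse (cosh z) ^ k
        + tanh z * (- of_nat k * (tanh z * inverse (cosh z) ^ k)) =
      (1 - of_nat (k + 1) * (tanh z)\<^sup>2) * inverse (cosh z) ^ k"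
    by (simp add: algebra_simps power2_eq_square)
  also have "\<dots> = of_nat (k + 1) * inverse (cosh z) ^ (k + 2) - of_nat k * inverse (cosh z) ^ k"
    unfolding tanh_square_strip[OF assms]
    by (simp add: algebra_simps power2_eq_square power_add)
  finally show ?thesis .
qed

text \<open>Each power \<open>sech\<^sup>k\<close> brings down \<open>- k * tanh\<close>. The
  resulting factors \<open>k\<^sup>2\<close> and \<open>(k + 1) * (k + 2)\<close> are those of
  \<open>arcsin_coeff_rec\<close>.\<close>

lemma has_field_derivative_tanh_sech_power_2:
  assumes "z \<in> strip"
  shows "((\<lambda>z. of_nat (k + 1) * inverse (cosh z) ^ (k + 2) - of_nat k * inverse (cosh z) ^ k)
           has_field_derivative
             of_nat (k\<^sup>2) * (tanh z * inverse (cosh z) ^ k)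
             - of_nat ((k + 1) * (k + 2)) * (tanh z * inverse (cosh z) ^ (k + 2))) (at z)"
  by (rule derivative_eq_intros has_field_derivative_sech_power assms refl)+
     (simp add: algebra_simps power2_eq_square)

section \<open>Reflection formulas for the digamma and trigamma functions\<close>

lemma Digamma_reflection:
  fixes z :: complex
  assumes "z \<notin> \<int>"
  shows "Digamma (1 - z) - Digamma z = of_real pi * cot (of_real pi * z)"
proof -
  have z: "z \<notin> \<int>\<^sub>\<le>\<^sub>0" "1 - z \<notin> \<int>\<^sub>\<le>\<^sub>0"
    using assms Ints_diff[of 1 "1 - z"] by auto
  have s: "sin (of_real pi * z) \<noteq> 0"
    using assms by (auto simp: sin_eq_0 Ints_def)
  \<comment> \<open>Both sides of \<open>Gamma z * Gamma (1 - z) = pi / sin (pi * z)\<close> are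
    differentiated; dividing by the common value leaves the logarithmic derivatives.\<close>
  have "((\<lambda>z. Gamma z * Gamma (1 - z)) has_field_derivative
      Gamma z * Gamma (1 - z) * (Digamma z - Digamma (1 - z))) (at z)"
    using z by (auto intro!: derivative_eq_intros simp: algebra_simps)
  moreover have "((\<lambda>z. of_real pi / sin (of_real pi * z)) has_field_derivative
      - of_real pi * (of_real pi * cos (of_real pi * z)) / (sin (of_real pi * z))\<^sup>2) (at z)"
    using s by (auto intro!: derivative_eq_intros simp: power2_eq_square)
  ultimately have "of_real pi / sin (of_real pi * z) * (Digamma z - Digamma (1 - z)) =
      - of_real pi * (of_real pi * cos (of_real pi * z)) / (sin (of_real pi * z))\<^sup>2"
    by (simp only: Gamma_reflection_complex DERIV_unique)
  also have "\<dots> = of_real pi / sin (of_real pi * z) * - (of_real pi * cot (of_real pi * z))"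
    by (simp add: cot_def power2_eq_square)
  finally have "Digamma z - Digamma (1 - z) = - (of_real pi * cot (of_real pi * z))"
    using s by (subst (asm) mult_cancel_left) simp
  then show ?thesis
    by (simp add: algebra_simps)
qed

text \<open>This is the derivative of \<open>Digamma_reflection\<close>, which holds on the open
  complement of the integers.\<close>

lemma Trigamma_reflection:
  fixes z :: complex
  assumes "z \<notin> \<int>"
  shows "Polygamma 1 z + Polygamma 1 (1 - z) = (of_real pi / sin (of_real pi * z))\<^sup>2"
proof -
  have z: "z \<notin> \<int>\<^sub>\<le>\<^sub>0" "1 - z \<notin> \<int>\<^sub>\<le>\<^sub>0"
    using assms Ints_diff[of 1 "1 - z"] by auto
  have s: "sin (of_real pi * z) \<noteq> 0"
    using assms by (auto simp: sin_eq_0 Ints_def)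
  have "((\<lambda>z. Digamma (1 - z) - Digamma z) has_field_derivative
      - Polygamma 1 (1 - z) - Polygamma 1 z) (at z)"
    using z by (auto intro!: derivative_eq_intros)
  moreover have "((\<lambda>z. of_real pi * cot (of_real pi * z)) has_field_derivative
      - ((of_real pi / sin (of_real pi * z))\<^sup>2)) (at z)"
    using s by (auto intro!: derivative_eq_intros DERIV_chain2[OF DERIV_cot]
        simp: power2_eq_square field_simps)
  then have "((\<lambda>z. Digamma (1 - z) - Digamma z) has_field_derivative
      - ((of_real pi / sin (of_real pi * z))\<^sup>2)) (at z)"
    by (rule has_field_derivative_transform_within_open[of _ _ _ "- \<int>"])
       (use assms in \<open>auto simp: Digamma_reflection\<close>)
  ultimately have "- Polygamma 1 (1 - z) - Polygamma 1 z = - ((of_real pi / sin (of_real pi * z))\<^sup>2)"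
    by (rule DERIV_unique)
  then show ?thesis
    by (simp add: algebra_simps)
qed

text \<open>
  Up to sign, \<open>Phi j\<close> is the derivative of order \<open>j\<close> of \<open>tanh\<close> (\<open>j\<close> even) or \<open>sech\<close> (\<open>j\<close> odd) divided by
  \<open>fact j\<close>.  The arguments \<open>1/4\<close> and \<open>3/4\<close> split the poles \<open>(2 l + 1) \<pi> / 2\<close> by the parity of \<open>l\<close>, so that the
  sign \<open>(-1) ^ j\<close> produces the alternating series in the odd case; writing the series as polygamma functions
  makes termwise differentiation available from the library.
\<close>
definition Phi :: "nat \<Rightarrow> complex \<Rightarrow> complex" where
  "Phi j z = \<i> * (-1) ^ j / (fact j * (2 * of_real pi) ^ (j + 1)) *
     (Polygamma j (1/4 - \<i> * z / (2 * of_real pi)) - Polygamma j (1/4 + \<i> * z / (2 * of_real pi)) +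
      (-1) ^ j * (Polygamma j (3/4 - \<i> * z / (2 * of_real pi))
                  - Polygamma j (3/4 + \<i> * z / (2 * of_real pi))))"

text \<open>The real part is \<open>- Im z / (2 * pi)\<close>. Adding \<open>1/4\<close> or
  \<open>3/4\<close> to plus or minus this argument therefore stays in the right half-plane, away
  from the poles of the polygamma functions.\<close>

lemma Re_strip_bounds:
  assumes "z \<in> strip"
  shows "\<bar>Re (\<i> * z / (2 * of_real pi))\<bar> < 1 / 4"
  using assms by (simp add: strip_def Re_divide_of_real[of _ "2 * pi", simplified] field_simps)

lemma not_nonpos_Ints_if_Re_pos: "Re z > 0 \<Longrightarrow> z \<notin> \<int>\<^sub>\<le>\<^sub>0" for z :: complex
  by (auto elim!: nonpos_Ints_cases)

lemma not_Ints_if_Re_between: "0 < Re z \<Longrightarrow> Re z < 1 \<Longrightarrow> z \<notin> \<int>" for z :: complex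
  by (auto elim!: Ints_cases)

lemma strip_quarter_arguments:
  assumes "z \<in> strip"
  shows "1/4 - \<i> * z / (2 * of_real pi) \<notin> \<int>\<^sub>\<le>\<^sub>0" "1/4 + \<i> * z / (2 * of_real pi) \<notin> \<int>\<^sub>\<le>\<^sub>0"
        "3/4 - \<i> * z / (2 * of_real pi) \<notin> \<int>\<^sub>\<le>\<^sub>0" "3/4 + \<i> * z / (2 * of_real pi) \<notin> \<int>\<^sub>\<le>\<^sub>0"
proof -
  define w where "w = \<i> * z / (2 * of_real pi)"
  have "\<bar>Re w\<bar> < 1 / 4"
    unfolding w_def by (rule Re_strip_bounds[OF assms])
  then show "1/4 - \<i> * z / (2 * of_real pi) \<notin> \<int>\<^sub>\<le>\<^sub>0" "1/4 + \<i> * z / (2 * of_real pi) \<notin> \<int>\<^sub>\<le>\<^sub>0"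
        "3/4 - \<i> * z / (2 * of_real pi) \<notin> \<int>\<^sub>\<le>\<^sub>0" "3/4 + \<i> * z / (2 * of_real pi) \<notin> \<int>\<^sub>\<le>\<^sub>0"
    unfolding w_def[symmetric]
    by (auto intro!: not_nonpos_Ints_if_Re_pos simp: abs_less_iff)
qed

text \<open>Differentiating once turns the differences of polygamma values into sums,
  differentiating again restores the differences at order \<open>j + 2\<close>. The intermediate
  function only links the two derivatives, so it stays existential.\<close>

lemma Phi_derivatives:
  obtains Phi' where
    "\<And>z. z \<in> strip \<Longrightarrow> (Phi j has_field_derivative Phi' z) (at z)"
    "\<And>z. z \<in> strip \<Longrightarrow> (Phi' has_field_derivative
       - of_nat ((j + 1) * (j + 2)) * Phi (j + 2) z) (at z)"
proof
  define c where "c = \<i> * (-1) ^ j / (fact j * (2 * of_real pi) ^ (j + 1))"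
  define w where "w z = \<i> * z / (2 * of_real pi)" for z
  have w [derivative_intros]: "(w has_field_derivative \<i> / (2 * of_real pi)) (at z)" for z
    unfolding w_def by (auto intro!: derivative_eq_intros)
  define Phi' where "Phi' z = - (c * (\<i> / (2 * of_real pi))) *
     (Polygamma (Suc j) (1/4 - w z) + Polygamma (Suc j) (1/4 + w z) +
      (-1) ^ j * (Polygamma (Suc j) (3/4 - w z) + Polygamma (Suc j) (3/4 + w z)))" for z
  fix z assume z: "z \<in> strip"
  note args = strip_quarter_arguments[OF z, folded w_def]
  have "Phi j = (\<lambda>z. c * (Polygamma j (1/4 - w z) - Polygamma j (1/4 + w z) +
      (-1) ^ j * (Polygamma j (3/4 - w z) - Polygamma j (3/4 + w z))))"
    by (simp add: fun_eq_iff Phi_def c_def w_def)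
  then show "(Phi j has_field_derivative Phi' z) (at z)"
    using args by (auto intro!: derivative_eq_intros w simp: Phi'_def algebra_simps)
  define e :: complex where "e = (-1) ^ j"
  \<comment> \<open>The square of \<open>\<i> / (2 * pi)\<close> supplies the minus sign and two
    powers of \<open>2 * pi\<close>; passing from \<open>fact j\<close> to
    \<open>fact (j + 2)\<close> supplies \<open>(j + 1) * (j + 2)\<close>.\<close>
  have c2: "c * (\<i> / (2 * of_real pi))\<^sup>2 =
      - of_nat ((j + 1) * (j + 2)) * (\<i> * (-1) ^ (j + 2) / (fact (j + 2) * (2 * of_real pi) ^ (j + 2 + 1)))"
  proof -
    define N F P where "N = complex_of_nat ((j + 1) * (j + 2))" and "F = (fact j :: complex)"
      and "P = 2 * complex_of_real pi"
    have nz: "N \<noteq> 0" "F \<noteq> 0" "P \<noteq> 0"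
      unfolding N_def F_def P_def of_nat_eq_0_iff by simp_all
    have fact: "fact (j + 2) = N * F"
      by (simp add: N_def F_def algebra_simps)
    have "P ^ (j + 2 + 1) = P ^ (j + 1) * P\<^sup>2"
      by (simp add: power2_eq_square)
    then show ?thesis
      unfolding c_def fact N_def[symmetric] F_def[symmetric] P_def[symmetric] using nz
      by (simp add: power_divide)
  qed
  have "(Phi' has_field_derivative c * (\<i> / (2 * of_real pi))\<^sup>2 *
     (Polygamma (j + 2) (1/4 - w z) - Polygamma (j + 2) (1/4 + w z) +
      (-1) ^ j * (Polygamma (j + 2) (3/4 - w z) - Polygamma (j + 2) (3/4 + w z)))) (at z)"
    unfolding Phi'_def[abs_def] e_def[symmetric] power2_eq_square using args
    by (auto intro!: derivative_eq_intros w simp: algebra_simps numeral_2_eq_2)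
  also have "c * (\<i> / (2 * of_real pi))\<^sup>2 *
     (Polygamma (j + 2) (1/4 - w z) - Polygamma (j + 2) (1/4 + w z) +
      (-1) ^ j * (Polygamma (j + 2) (3/4 - w z) - Polygamma (j + 2) (3/4 + w z))) =
      - of_nat ((j + 1) * (j + 2)) * Phi (j + 2) z"
    unfolding c2 Phi_def w_def by (simp del: of_nat_mult of_nat_add)
  finally show "(Phi' has_field_derivative - of_nat ((j + 1) * (j + 2)) * Phi (j + 2) z) (at z)" .
qed

text \<open>Since \<open>3/4 + w = 1 - (1/4 - w)\<close>, the four polygamma values pair up under
  reflection. The angles become \<open>u\<close> and \<open>pi / 2 - u\<close> with
  \<open>2 * u = pi / 2 - \<i> * z\<close>, and the double-angle formulas produce
  \<open>cosh z\<close> and \<open>\<i> * sinh z\<close>.\<close>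

lemma Phi_base:
  assumes "z \<in> strip"
  shows "Phi 0 z = tanh z" "Phi 1 z = tanh z * inverse (cosh z)"
proof -
  define w where "w = \<i> * z / (2 * of_real pi)"
  define u where "u = of_real pi * (1/4 - w)"
  have "\<bar>Re w\<bar> < 1 / 4"
    unfolding w_def by (rule Re_strip_bounds[OF assms])
  then have Re: "0 < Re (1/4 - w)" "Re (1/4 - w) < 1" "0 < Re (1/4 + w)" "Re (1/4 + w) < 1"
    by (auto simp: abs_less_iff)
  note ni = not_Ints_if_Re_between[OF Re(1,2)] not_Ints_if_Re_between[OF Re(3,4)]
  have v: "of_real pi * (1/4 + w) = of_real pi / 2 - u"
    by (simp add: u_def algebra_simps)
  have sv: "sin (of_real pi / 2 - u) = cos u" and cv: "cos (of_real pi / 2 - u) = sin u"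
    by (simp_all add: sin_diff cos_diff)
  have u2: "2 * u = of_real pi / 2 - \<i> * z"
    by (simp add: u_def w_def algebra_simps)
  have s2: "2 * sin u * cos u = cosh z"
    unfolding sin_double[symmetric] u2 by (simp add: sin_diff cosh_conv_cos)
  have c2: "(cos u)\<^sup>2 - (sin u)\<^sup>2 = \<i> * sinh z"
    unfolding cos_double[symmetric] u2 by (simp add: cos_diff sinh_conv_sin)
  have nz: "sin u \<noteq> 0" "cos u \<noteq> 0"
    using s2 cosh_nonzero_strip[OF assms] by auto
  have "Phi 0 z = \<i> / (2 * of_real pi) *
     ((Digamma (1 - (1/4 + w)) - Digamma (1/4 + w)) - (Digamma (1 - (1/4 - w)) - Digamma (1/4 - w)))"
    by (simp add: Phi_def w_def algebra_simps)
  also have "\<dots> = \<i> / 2 * (sin u / cos u - cos u / sin u)"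
    unfolding Digamma_reflection[OF ni(1)] Digamma_reflection[OF ni(2)] v u_def[symmetric] cot_def sv cv
    by (simp add: right_diff_distrib)
  also have "\<dots> = - \<i> * ((cos u)\<^sup>2 - (sin u)\<^sup>2) / (2 * sin u * cos u)"
    using nz by (simp add: field_simps power2_eq_square)
  also have "\<dots> = tanh z"
    unfolding c2 s2 by (simp add: tanh_def)
  finally show "Phi 0 z = tanh z" .
  have "Phi 1 z = - \<i> / (2 * of_real pi)\<^sup>2 *
     ((Polygamma 1 (1/4 - w) + Polygamma 1 (1 - (1/4 - w))) - (Polygamma 1 (1/4 + w) + Polygamma 1 (1 - (1/4 + w))))"
    by (simp add: Phi_def w_def algebra_simps power2_eq_square)
  also have "\<dots> = - \<i> / 4 * (1 / (sin u)\<^sup>2 - 1 / (cos u)\<^sup>2)"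
    unfolding Trigamma_reflection[OF ni(1)] Trigamma_reflection[OF ni(2)] v u_def[symmetric] sv
    by (simp add: power_divide right_diff_distrib power2_eq_square)
  also have "\<dots> = - \<i> * ((cos u)\<^sup>2 - (sin u)\<^sup>2) / (2 * sin u * cos u)\<^sup>2"
    using nz by (simp add: field_simps power2_eq_square)
  also have "\<dots> = tanh z * inverse (cosh z)"
    unfolding c2 s2 by (simp add: tanh_def field_simps power2_eq_square)
  finally show "Phi 1 z = tanh z * inverse (cosh z)" .
qed

text \<open>By induction on \<open>m\<close>: the expansion of order \<open>k\<close> is
  differentiated twice on the strip. This yields order \<open>k + 2\<close> on the left and shifts
  the \<open>Phi\<close> indices on the right; \<open>arcsin_coeff_rec\<close> then identifies the
  coefficients.\<close>

lemma tanh_sech_power_expansion: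
  assumes "s \<in> {0, 1}" "z \<in> strip"
  shows "tanh z * inverse (cosh z) ^ (2 * m + s) =
           (\<Sum>p\<le>m. arcsin_coeff (2 * p + s) (2 * m + s) * Phi (2 * p + s) z)"
  using assms(2)
proof (induction m arbitrary: z)
  case 0
  then show ?case
    using assms(1) Phi_base[OF 0] by (auto simp: arcsin_coeff_0 arcsin_coeff_1_1)
next
  case (Suc m)
  define k where "k = 2 * m + s"
  define c where "c p = arcsin_coeff (2 * p + s) k" for p
  define f where "f p = Phi (2 * p + s)" for p
  \<comment> \<open>One intermediate derivative is chosen for each \<open>p\<close>, so that finite
    sums can be differentiated twice.\<close>
  have "\<exists>f'. \<forall>z\<in>strip. (f p has_field_derivative f' z) (at z) \<and>
      (f' has_field_derivative - of_nat ((2 * p + s + 1) * (2 * p + s + 2)) * f (p + 1) z) (at z)" for p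
  proof -
    have "2 * (p + 1) + s = 2 * p + s + 2" by simp
    then show ?thesis
      unfolding f_def by (metis Phi_derivatives[of "2 * p + s"])
  qed
  then obtain f' where f': "\<And>p z. z \<in> strip \<Longrightarrow> (f p has_field_derivative f' p z) (at z)"
    "\<And>p z. z \<in> strip \<Longrightarrow> (f' p has_field_derivative
        - of_nat ((2 * p + s + 1) * (2 * p + s + 2)) * f (p + 1) z) (at z)"
    by metis
  have IH: "tanh z * inverse (cosh z) ^ k = (\<Sum>p\<le>m. c p * f p z)" if "z \<in> strip" for z
    using Suc.IH[OF that] by (simp add: k_def c_def f_def)
  \<comment> \<open>The identity is needed on the whole strip, not only at the given point, because
    it is differentiated again.\<close>
  have D1: "of_nat (k + 1) * inverse (cosh z) ^ (k + 2) - of_nat k * inverse (cosh z) ^ k =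
      (\<Sum>p\<le>m. c p * f' p z)" if "z \<in> strip" for z
  proof (rule DERIV_unique)
    show "((\<lambda>z. tanh z * inverse (cosh z) ^ k) has_field_derivative
        of_nat (k + 1) * inverse (cosh z) ^ (k + 2) - of_nat k * inverse (cosh z) ^ k) (at z)"
      by (rule has_field_derivative_tanh_sech_power[OF that])
    have "((\<lambda>z. \<Sum>p\<le>m. c p * f p z) has_field_derivative (\<Sum>p\<le>m. c p * f' p z)) (at z)"
      using f'(1)[OF that] by (intro DERIV_sum DERIV_cmult)
    then show "((\<lambda>z. tanh z * inverse (cosh z) ^ k) has_field_derivative (\<Sum>p\<le>m. c p * f' p z)) (at z)"
      by (rule has_field_derivative_transform_within_open[OF _ open_strip that]) (simp add: IH)
  qed
  have D2: "of_nat (k\<^sup>2) * (tanh z * inverse (cosh z) ^ k)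
             - of_nat ((k + 1) * (k + 2)) * (tanh z * inverse (cosh z) ^ (k + 2)) =
      (\<Sum>p\<le>m. c p * (- of_nat ((2 * p + s + 1) * (2 * p + s + 2)) * f (p + 1) z))"
  proof (rule DERIV_unique)
    show "((\<lambda>z. of_nat (k + 1) * inverse (cosh z) ^ (k + 2) - of_nat k * inverse (cosh z) ^ k)
           has_field_derivative
             of_nat (k\<^sup>2) * (tanh z * inverse (cosh z) ^ k)
             - of_nat ((k + 1) * (k + 2)) * (tanh z * inverse (cosh z) ^ (k + 2))) (at z)"
      by (rule has_field_derivative_tanh_sech_power_2[OF Suc.prems])
    have "((\<lambda>z. \<Sum>p\<le>m. c p * f' p z) has_field_derivative
        (\<Sum>p\<le>m. c p * (- of_nat ((2 * p + s + 1) * (2 * p + s + 2)) * f (p + 1) z))) (at z)"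
      using f'(2)[OF Suc.prems] by (intro DERIV_sum DERIV_cmult)
    then show "((\<lambda>z. of_nat (k + 1) * inverse (cosh z) ^ (k + 2) - of_nat k * inverse (cosh z) ^ k)
        has_field_derivative
        (\<Sum>p\<le>m. c p * (- of_nat ((2 * p + s + 1) * (2 * p + s + 2)) * f (p + 1) z))) (at z)"
      by (rule has_field_derivative_transform_within_open[OF _ open_strip Suc.prems]) (simp only: D1)
  qed
  \<comment> \<open>With \<open>j = 2 * p + s\<close>, this is the term
    \<open>j * (j - 1) * arcsin_coeff (j - 2) k\<close> of the recurrence: the right-hand side of
    \<open>D2\<close> after the shift from \<open>p + 1\<close> to \<open>p\<close>.\<close>
  define g where "g p = (if p = 0 then 0 else
      c (p - 1) * of_nat ((2 * p + s) * (2 * p + s - 1)) * f p z)" for p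
  have solve: "x = y + g" if "a = y" "a - x = - g" for a x y g :: complex
    using that by (auto simp: diff_eq_eq)
  have "(\<Sum>p\<le>m. c p * (- of_nat ((2 * p + s + 1) * (2 * p + s + 2)) * f (p + 1) z)) =
      - (\<Sum>p\<le>m. c p * (of_nat ((2 * p + s + 1) * (2 * p + s + 2)) * f (p + 1) z))"
    by (simp only: mult_minus_left mult_minus_right sum_negf)
  also have "(\<Sum>p\<le>m. c p * (of_nat ((2 * p + s + 1) * (2 * p + s + 2)) * f (p + 1) z)) = (\<Sum>p\<le>Suc m. g p)"
    unfolding sum.atMost_Suc_shift by (simp add: g_def algebra_simps)
  finally have shift: "(\<Sum>p\<le>m. c p * (- of_nat ((2 * p + s + 1) * (2 * p + s + 2)) * f (p + 1) z)) =
      - (\<Sum>p\<le>Suc m. g p)" .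
  have "of_nat (k\<^sup>2) * (tanh z * inverse (cosh z) ^ k) = (\<Sum>p\<le>m. of_nat (k\<^sup>2) * (c p * f p z))"
    by (simp only: IH[OF Suc.prems] sum_distrib_left)
  \<comment> \<open>The added term is zero: a power of the arcsine has no coefficient below its
    order, and here the order is \<open>k + 2\<close>.\<close>
  also have "\<dots> = (\<Sum>p\<le>Suc m. of_nat (k\<^sup>2) * (c p * f p z))"
    by (simp add: c_def k_def arcsin_coeff_eq_0)
  finally have "of_nat ((k + 1) * (k + 2)) * (tanh z * inverse (cosh z) ^ (k + 2)) =
      (\<Sum>p\<le>Suc m. of_nat (k\<^sup>2) * (c p * f p z)) + (\<Sum>p\<le>Suc m. g p)"
    using D2 unfolding shift by (rule solve)
  then have "of_nat ((k + 1) * (k + 2)) * (tanh z * inverse (cosh z) ^ (k + 2)) =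
      (\<Sum>p\<le>Suc m. of_nat (k\<^sup>2) * (c p * f p z) + g p)"
    by (simp only: sum.distrib)
  also have "\<dots> = (\<Sum>p\<le>Suc m. of_nat ((k + 1) * (k + 2)) * (arcsin_coeff (2 * p + s) (k + 2) * f p z))"
  proof (intro sum.cong refl)
    fix p
    have "of_nat (k\<^sup>2) * (c p * f p z) + g p =
        (of_nat (k\<^sup>2) * arcsin_coeff (2 * p + s) k
          + of_nat ((2 * p + s) * (2 * p + s - 1)) * arcsin_coeff (2 * p + s - 2) k) * f p z"
    proof (cases p)
      \<comment> \<open>Here \<open>j = s\<close> is 0 or 1, so \<open>j * (j - 1) = 0\<close>
        agrees with \<open>g 0 = 0\<close>.\<close>
      case 0
      then show ?thesis using assms(1) by (auto simp: g_def c_def)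
    next
      case (Suc q)
      then have "2 * p + s - 2 = 2 * q + s" by simp
      with Suc show ?thesis by (simp add: g_def c_def algebra_simps)
    qed
    then show "of_nat (k\<^sup>2) * (c p * f p z) + g p =
        of_nat ((k + 1) * (k + 2)) * (arcsin_coeff (2 * p + s) (k + 2) * f p z)"
      by (simp only: arcsin_coeff_rec[symmetric] mult.assoc)
  qed
  also have "\<dots> = of_nat ((k + 1) * (k + 2)) * (\<Sum>p\<le>Suc m. arcsin_coeff (2 * p + s) (k + 2) * f p z)"
    by (simp only: sum_distrib_left)
  finally have "tanh z * inverse (cosh z) ^ (k + 2) = (\<Sum>p\<le>Suc m. arcsin_coeff (2 * p + s) (k + 2) * f p z)"
    unfolding mult_cancel_left of_nat_eq_0_iff by simp
  moreover have "k + 2 = 2 * Suc m + s" by (simp add: k_def)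
  ultimately show ?case by (simp only: f_def)
qed

section \<open>Integrals of pole pairs\<close>

lemma DERIV_arctan_scaled:
  assumes "a > 0"
  shows "DERIV (\<lambda>t. arctan (t / a)) t :> a / (a\<^sup>2 + t\<^sup>2)"
proof -
  have "DERIV (\<lambda>t. arctan (t / a)) t :> inverse (1 + (t / a)\<^sup>2) * (1 / a)"
    using assms by (auto intro!: derivative_eq_intros)
  also have "1 + (t / a)\<^sup>2 = (a\<^sup>2 + t\<^sup>2) / a\<^sup>2"
    using assms by (simp add: power_divide add_divide_distrib)
  also have "inverse \<dots> * (1 / a) = a / (a\<^sup>2 + t\<^sup>2)"
    using assms by (simp add: power2_eq_square)
  finally show ?thesis .
qed

text \<open>The integrand is positive, so the limits of the antiderivative
  \<open>arctan (t / a) / a\<close> give integrability and value together. Multiples of it dominate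
  all pole kernels.\<close>

lemma inverse_square_plus_integral:
  assumes "a > 0"
  shows "set_integrable lborel {0<..} (\<lambda>t. 1 / (a\<^sup>2 + t\<^sup>2))"
    and "(LBINT t:{0<..}. 1 / (a\<^sup>2 + t\<^sup>2)) = pi / (2 * a)"
proof -
  have sum: "a\<^sup>2 + t\<^sup>2 \<noteq> 0" for t
    using assms by (simp add: sum_power2_eq_zero_iff)
  have deriv: "DERIV (\<lambda>t. arctan (t / a) / a) t :> 1 / (a\<^sup>2 + t\<^sup>2)" for t
    using DERIV_cdivide[OF DERIV_arctan_scaled[OF assms, of t], of a] assms by simp
  have cont: "isCont (\<lambda>t. 1 / (a\<^sup>2 + t\<^sup>2)) t" for t
    using sum by (intro continuous_intros) auto
  have lim0: "((\<lambda>t. arctan (t / a) / a) \<longlongrightarrow> 0) (at_right 0)"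
    by (rule tendsto_eq_intros refl | use assms in simp)+
  have "((\<lambda>t. arctan (t / a)) \<longlongrightarrow> pi / 2) at_top"
    by (rule filterlim_compose[OF tendsto_arctan_at_top])
       (use assms in \<open>auto intro!: filterlim_tendsto_pos_mult_at_top[OF tendsto_const _ filterlim_ident]
         simp: divide_inverse mult.commute[of _ "inverse a"]\<close>)
  then have lim: "((\<lambda>t. arctan (t / a) / a) \<longlongrightarrow> pi / 2 / a) at_top"
    by (intro tendsto_divide tendsto_const) (use assms in auto)
  have "set_integrable lborel (einterval 0 \<infinity>) (\<lambda>t. 1 / (a\<^sup>2 + t\<^sup>2))"
    "(LBINT t=0..\<infinity>. 1 / (a\<^sup>2 + t\<^sup>2)) = pi / 2 / a - 0"
    by (rule interval_integral_FTC_nonneg[where F = "\<lambda>t. arctan (t / a) / a"];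
        use deriv cont lim0 lim in \<open>simp add: zero_ereal_def ereal_tendsto_simps del: ereal_eq_0\<close>)+
  then show "set_integrable lborel {0<..} (\<lambda>t. 1 / (a\<^sup>2 + t\<^sup>2))"
    "(LBINT t:{0<..}. 1 / (a\<^sup>2 + t\<^sup>2)) = pi / (2 * a)"
    by (simp_all add: interval_lebesgue_integral_0_infty einterval_eq_Ici[of 0, folded zero_ereal_def])
qed

text \<open>The poles form the conjugate pair \<open>\<i> * a\<close>, \<open>- \<i> * a\<close>.
  The numerator vanishes at \<open>t = 0\<close>, so the division by \<open>t\<close> creates no
  singularity there.\<close>

definition pole_kernel :: "nat \<Rightarrow> real \<Rightarrow> real \<Rightarrow> complex" where
  "pole_kernel m a t = (inverse (of_real a - \<i> * of_real t) ^ m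
                        - inverse (of_real a + \<i> * of_real t) ^ m) / of_real t"

lemma of_real_plus_i_nonzero:
  "a > 0 \<Longrightarrow> of_real a - \<i> * of_real t \<noteq> 0" "a > 0 \<Longrightarrow> of_real a + \<i> * of_real t \<noteq> 0"
  by (auto simp: complex_eq_iff)

lemma borel_measurable_pole_kernel [measurable]: "pole_kernel m a \<in> borel_measurable borel"
  unfolding pole_kernel_def by measurable

lemma pole_kernel_1:
  assumes "a > 0" "t > 0"
  shows "pole_kernel 1 a t = 2 * \<i> / of_real (a\<^sup>2 + t\<^sup>2)"
proof -
  define x y where "x = of_real a - \<i> * of_real t" and "y = of_real a + \<i> * of_real t"
  have "x \<noteq> 0" "y \<noteq> 0"
    using of_real_plus_i_nonzero[OF assms(1), of t] by (simp_all add: x_def y_def)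
  then have "inverse x - inverse y = (y - x) / (x * y)"
    by (simp add: field_simps)
  also have "y - x = 2 * \<i> * of_real t"
    by (simp add: x_def y_def)
  also have "x * y = of_real (a\<^sup>2 + t\<^sup>2)"
    by (simp add: x_def y_def algebra_simps power2_eq_square)
  finally show ?thesis
    using assms(2) by (simp add: pole_kernel_def x_def y_def)
qed

text \<open>After multiplication by \<open>a\<close> both inverses lie in the closed unit disc,
  where the difference of \<open>m\<close>-th powers is at most \<open>m\<close> times the
  difference. This reduces the bound to the explicit kernel of order 1.\<close>

lemma norm_pole_kernel_le:
  assumes "a > 0" "t > 0"
  shows "norm (pole_kernel m a t) \<le> 2 * real m * a / a ^ m * (1 / (a\<^sup>2 + t\<^sup>2))"
proof -
  define u where "u = inverse (of_real a - \<i> * of_real t)"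
  define v where "v = inverse (of_real a + \<i> * of_real t)"
  have kernel: "pole_kernel l a t = (u ^ l - v ^ l) / of_real t" for l
    by (simp add: pole_kernel_def u_def v_def)
  have "a \<le> norm (of_real a - \<i> * of_real t)" "a \<le> norm (of_real a + \<i> * of_real t)"
    using complex_Re_le_cmod[of "of_real a - \<i> * of_real t"]
      complex_Re_le_cmod[of "of_real a + \<i> * of_real t"] by auto
  then have "norm (of_real a * u) \<le> 1" "norm (of_real a * v) \<le> 1"
    using assms by (auto simp: u_def v_def norm_mult norm_inverse norm_divide inverse_eq_divide divide_le_eq_1)
  then have "norm ((of_real a * u) ^ m - (of_real a * v) ^ m) \<le> m * norm (of_real a * u - of_real a * v)"
    by (rule norm_power_diff)
  also have "(of_real a * u) ^ m - (of_real a * v) ^ m = of_real (a ^ m) * (u ^ m - v ^ m)"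
    by (simp add: power_mult_distrib algebra_simps)
  also have "of_real a * u - of_real a * v = of_real (a * t) * pole_kernel 1 a t"
    using assms by (simp add: kernel right_diff_distrib[symmetric])
  also have "u ^ m - v ^ m = of_real t * pole_kernel m a t"
    using assms by (simp add: kernel)
  finally have "a ^ m * (t * norm (pole_kernel m a t)) \<le> m * (a * t * norm (pole_kernel 1 a t))"
    using assms by (simp add: norm_mult norm_power)
  also have "norm (pole_kernel 1 a t) = 2 / (a\<^sup>2 + t\<^sup>2)"
    unfolding pole_kernel_1[OF assms] norm_divide norm_of_real by (simp add: norm_mult)
  finally have "t * (a ^ m * norm (pole_kernel m a t)) \<le> t * (2 * m * a * (1 / (a\<^sup>2 + t\<^sup>2)))"
    by (simp add: mult_ac)
  then have "a ^ m * norm (pole_kernel m a t) \<le> 2 * m * a * (1 / (a\<^sup>2 + t\<^sup>2))"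
    using assms(2) by (simp only: mult_le_cancel_left_pos)
  then have "norm (pole_kernel m a t) \<le> 2 * m * a * (1 / (a\<^sup>2 + t\<^sup>2)) / a ^ m"
    using assms(1) by (simp only: pos_le_divide_eq zero_less_power mult.commute[of _ "a ^ m"])
  then show ?thesis
    by (simp add: mult_ac)
qed

lemma pole_kernel_integrable:
  assumes "a > 0"
  shows "set_integrable lborel {0<..} (pole_kernel m a)"
    and "(LBINT t:{0<..}. norm (pole_kernel m a t)) \<le> real m * pi / a ^ m"
proof -
  have bound: "set_integrable lborel {0<..} (\<lambda>t. 2 * real m * a / a ^ m * (1 / (a\<^sup>2 + t\<^sup>2)))"
    by (intro set_integrable_mult_right inverse_square_plus_integral assms)
  show int: "set_integrable lborel {0<..} (pole_kernel m a)"
  proof (rule set_integrable_bound[OF bound])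
    show "set_borel_measurable lborel {0<..} (pole_kernel m a)"
      unfolding set_borel_measurable_def by measurable
    have "norm (pole_kernel m a t) \<le> norm (2 * real m * a / a ^ m * (1 / (a\<^sup>2 + t\<^sup>2)))"
      if "t \<in> {0<..}" for t
      unfolding real_norm_def using that assms
      by (intro order_trans[OF norm_pole_kernel_le abs_ge_self]) auto
    then show "AE t in lborel. t \<in> {0<..} \<longrightarrow>
        norm (pole_kernel m a t) \<le> norm (2 * real m * a / a ^ m * (1 / (a\<^sup>2 + t\<^sup>2)))"
      by blast
  qed
  have "(LBINT t:{0<..}. norm (pole_kernel m a t))
      \<le> (LBINT t:{0<..}. 2 * real m * a / a ^ m * (1 / (a\<^sup>2 + t\<^sup>2)))"
    using norm_pole_kernel_le[OF assms] by (intro set_integral_mono set_integrable_norm int bound) auto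
  also have "\<dots> = real m * pi / a ^ m"
    unfolding set_integral_mult_right inverse_square_plus_integral(2)[OF assms] using assms by simp
  finally show "(LBINT t:{0<..}. norm (pole_kernel m a t)) \<le> real m * pi / a ^ m" .
qed

lemma has_vector_derivative_inverse_power:
  assumes "of_real a + c * of_real t \<noteq> (0 :: complex)"
  shows "((\<lambda>t. inverse (of_real a + c * of_real t) ^ m) has_vector_derivative
            - of_nat m * c * inverse (of_real a + c * of_real t) ^ (m + 1)) (at t)"
proof (rule has_vector_derivative_real_field)
  show "((\<lambda>z. inverse (of_real a + c * z) ^ m) has_field_derivative
            - of_nat m * c * inverse (of_real a + c * of_real t) ^ (m + 1)) (at (of_real t))"
  proof -
    have "((\<lambda>z. inverse (of_real a + c * z)) has_field_derivative
              - c * (inverse (of_real a + c * of_real t))\<^sup>2) (at (of_real t))"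
      using assms by (auto intro!: derivative_eq_intros simp: power2_eq_square)
    from DERIV_power[OF this, of m] show ?thesis
      by (cases m) (simp_all add: power2_eq_square algebra_simps)
  qed
qed

text \<open>With \<open>u\<close>, \<open>v\<close> the two inverses,
  \<open>a * u = 1 + \<i> * t * u\<close> and \<open>a * v = 1 - \<i> * t * v\<close>. Hence
  \<open>a\<close> times the kernel of order \<open>k + 1\<close> is the kernel of order
  \<open>k\<close> plus the derivative of \<open>(u ^ k - v ^ k) / k\<close>. That extra term
  vanishes at both ends, so each step only divides the limit by \<open>a\<close>.\<close>

lemma pole_kernel_antiderivative:
  assumes a: "a > 0"
  shows "\<exists>F. (\<forall>t>0. (F has_vector_derivative pole_kernel (Suc m) a t) (at t)) \<and>
             (F \<longlongrightarrow> 0) (at_right 0) \<and> (F \<longlongrightarrow> \<i> * of_real (pi / a ^ Suc m)) at_top"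
proof (induction m)
  case 0
  let ?F = "\<lambda>t. of_real (2 / a * arctan (t / a)) * \<i>"
  have "(?F has_vector_derivative pole_kernel (Suc 0) a t) (at t)" if "t > 0" for t
  proof -
    have "DERIV (\<lambda>t. 2 / a * arctan (t / a)) t :> 2 / (a\<^sup>2 + t\<^sup>2)"
      using DERIV_cmult[OF DERIV_arctan_scaled[OF a, of t], of "2 / a"] a by simp
    then have "(?F has_vector_derivative of_real (2 / (a\<^sup>2 + t\<^sup>2)) * \<i>) (at t)"
      by (intro has_vector_derivative_mult_left has_vector_derivative_of_real)
         (simp add: has_real_derivative_iff_has_vector_derivative)
    then show ?thesis
      using pole_kernel_1[OF a that] by (simp add: mult.commute)
  qed
  moreover have "(?F \<longlongrightarrow> of_real (2 / a * arctan (0 / a)) * \<i>) (at_right 0)"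
    by (intro tendsto_intros) (use a in auto)
  moreover have "((\<lambda>t. arctan (t / a)) \<longlongrightarrow> pi / 2) at_top"
    by (rule filterlim_compose[OF tendsto_arctan_at_top])
       (use assms in \<open>auto intro!: filterlim_tendsto_pos_mult_at_top[OF tendsto_const _ filterlim_ident]
         simp: divide_inverse mult.commute[of _ "inverse a"]\<close>)
  then have "(?F \<longlongrightarrow> of_real (2 / a * (pi / 2)) * \<i>) at_top"
    by (intro tendsto_intros)
  ultimately show ?case
    by (intro exI[of _ ?F]) (simp add: mult.commute)
next
  case (Suc m)
  define u where "u t = inverse (of_real a + (-\<i>) * of_real t)" for t
  define v where "v t = inverse (of_real a + \<i> * of_real t)" for t
  define k where "k = Suc m"
  have "k > 0" by (simp add: k_def)
  have ne: "of_real a + (-\<i>) * of_real t \<noteq> 0" "of_real a + \<i> * of_real t \<noteq> 0" for t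
    using of_real_plus_i_nonzero[OF a, of t] by simp_all
  from Suc.IH obtain F where F: "\<And>t. t > 0 \<Longrightarrow> (F has_vector_derivative pole_kernel k a t) (at t)"
    "(F \<longlongrightarrow> 0) (at_right 0)" "(F \<longlongrightarrow> \<i> * of_real (pi / a ^ k)) at_top"
    unfolding k_def by blast
  let ?G = "\<lambda>t. inverse (of_real a) * (F t + inverse (of_nat k) * (u t ^ k - v t ^ k))"
  have "(?G has_vector_derivative pole_kernel (Suc k) a t) (at t)" if "t > 0" for t
  proof -
    have "(?G has_vector_derivative
        inverse (of_real a) * (pole_kernel k a t + inverse (of_nat k) *
          (- of_nat k * (-\<i>) * u t ^ (k + 1) - (- of_nat k * \<i> * v t ^ (k + 1))))) (at t)"
      unfolding u_def v_def using F(1)[OF that] ne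
      by (intro has_vector_derivative_mult_right has_vector_derivative_add has_vector_derivative_diff
          has_vector_derivative_inverse_power) auto
    also have "inverse (of_nat k) *
          (- of_nat k * (-\<i>) * u t ^ (k + 1) - (- of_nat k * \<i> * v t ^ (k + 1))) =
        \<i> * (u t ^ (k + 1) + v t ^ (k + 1))"
      using \<open>k > 0\<close> by (simp add: field_simps)
    also have "inverse (of_real a) * (pole_kernel k a t + \<i> * (u t ^ (k + 1) + v t ^ (k + 1))) =
        pole_kernel (Suc k) a t"
    proof -
      have "u t * (of_real a - \<i> * of_real t) = 1" "v t * (of_real a + \<i> * of_real t) = 1"
        using ne[of t] by (simp_all add: u_def v_def)
      then have "of_real a * u t = 1 + \<i> * of_real t * u t" "of_real a * v t = 1 - \<i> * of_real t * v t"
        by (simp_all add: algebra_simps)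
      then have "of_real a * u t * u t ^ k - of_real a * v t * v t ^ k =
          (1 + \<i> * of_real t * u t) * u t ^ k - (1 - \<i> * of_real t * v t) * v t ^ k"
        by simp
      then have "of_real a * (u t * u t ^ k - v t * v t ^ k) =
          u t ^ k - v t ^ k + of_real t * (\<i> * (u t * u t ^ k + v t * v t ^ k))"
        by (simp add: algebra_simps)
      moreover have "x = inverse c * y" if "c * x = y" "c \<noteq> 0" for c x y :: complex
        using that by auto
      moreover have "complex_of_real a \<noteq> 0"
        using a by simp
      ultimately have "u t * u t ^ k - v t * v t ^ k = inverse (of_real a) *
          (u t ^ k - v t ^ k + of_real t * (\<i> * (u t * u t ^ k + v t * v t ^ k)))"
        by blast
      moreover have kernel: "pole_kernel l a t = (u t ^ l - v t ^ l) / of_real t" for l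
        by (simp add: pole_kernel_def u_def v_def)
      ultimately have "pole_kernel (Suc k) a t = inverse (of_real a) *
          (u t ^ k - v t ^ k + of_real t * (\<i> * (u t * u t ^ k + v t * v t ^ k))) / of_real t"
        by (simp only: kernel power_Suc)
      also have "\<dots> = inverse (of_real a) *
          ((u t ^ k - v t ^ k) / of_real t + \<i> * (u t * u t ^ k + v t * v t ^ k))"
      proof -
        have "c * (x + y * w) / y = c * (x / y + w)" if "y \<noteq> 0" for c x y w :: complex
          using that by (simp add: field_simps)
        then show ?thesis
          using that by simp
      qed
      finally show ?thesis
        by (simp add: kernel)
    qed
    finally show ?thesis .
  qed
  moreover have "(?G \<longlongrightarrow> inverse (of_real a) * (0 + inverse (of_nat k) * (u 0 ^ k - v 0 ^ k))) (at_right 0)"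
  proof -
    have "(u \<longlongrightarrow> u 0) (at_right 0)" "(v \<longlongrightarrow> v 0) (at_right 0)"
      unfolding u_def v_def by (intro tendsto_intros ne)+
    then show ?thesis
      by (intro tendsto_intros F(2))
  qed
  moreover have "(?G \<longlongrightarrow> inverse (of_real a) *
      (\<i> * of_real (pi / a ^ k) + inverse (of_nat k) * (0 ^ k - 0 ^ k))) at_top"
  proof -
    \<comment> \<open>The denominators have imaginary part of absolute value \<open>t\<close>, so
      both inverses tend to 0.\<close>
    have "norm (u t) \<le> inverse t" "norm (v t) \<le> inverse t" if "t > 0" for t
    proof -
      have "t \<le> norm (of_real a + (-\<i>) * of_real t)" "t \<le> norm (of_real a + \<i> * of_real t)"
        using abs_Im_le_cmod[of "of_real a + (-\<i>) * of_real t"]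
          abs_Im_le_cmod[of "of_real a + \<i> * of_real t"] that by auto
      then show "norm (u t) \<le> inverse t" "norm (v t) \<le> inverse t"
        using that unfolding u_def v_def norm_inverse by (auto intro!: le_imp_inverse_le)
    qed
    then have ev: "eventually (\<lambda>t. norm (u t) \<le> inverse t) at_top" "eventually (\<lambda>t. norm (v t) \<le> inverse t) at_top"
      by (auto intro: eventually_mono[OF eventually_gt_at_top[of 0]])
    note lim = Lim_null_comparison[OF _ tendsto_inverse_0_at_top[OF filterlim_ident]]
    show ?thesis
      by (intro tendsto_intros F(3) lim[OF ev(1)] lim[OF ev(2)])
  qed
  ultimately show ?case
    unfolding k_def[symmetric]
    by (intro exI[of _ ?G]) (use \<open>k > 0\<close> in \<open>simp add: u_def v_def power_0_left field_simps\<close>)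
qed

lemma integral_pole_kernel:
  assumes "a > 0" "m > 0"
  shows "(LBINT t:{0<..}. pole_kernel m a t) = \<i> * of_real (pi / a ^ m)"
proof -
  obtain F where F: "\<And>t. t > 0 \<Longrightarrow> (F has_vector_derivative pole_kernel m a t) (at t)"
    "(F \<longlongrightarrow> 0) (at_right 0)" "(F \<longlongrightarrow> \<i> * of_real (pi / a ^ m)) at_top"
    using pole_kernel_antiderivative[OF assms(1), of "m - 1"] assms(2) by auto
  have cont: "isCont (pole_kernel m a) t" if "t > 0" for t
    unfolding pole_kernel_def[abs_def] using that of_real_plus_i_nonzero[OF assms(1)]
    by (intro continuous_intros) auto
  have "(LBINT t=0..\<infinity>. pole_kernel m a t) = \<i> * of_real (pi / a ^ m) - 0"
    by (rule interval_integral_FTC_integrable[where F = F];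
        use F cont pole_kernel_integrable(1)[OF assms(1)] in
          \<open>simp add: zero_ereal_def ereal_tendsto_simps del: ereal_eq_0\<close>)
  then show ?thesis
    by (simp add: interval_lebesgue_integral_0_infty)
qed

section \<open>Integrals of the partial fraction series\<close>

lemma summable_inverse_power_arith:
  assumes "0 < b" "0 < c" "m \<ge> 2"
  shows "summable (\<lambda>r. 1 / (b * real r + c) ^ m)"
proof -
  have "summable (\<lambda>r. inverse (b ^ m) * inverse ((c / b + of_nat r) ^ m))"
    using assms by (intro summable_mult Polygamma_converges') auto
  also have "(\<lambda>r. inverse (b ^ m) * inverse ((c / b + of_nat r) ^ m)) = (\<lambda>r. 1 / (b * real r + c) ^ m)"
  proof
    fix r
    have "b * real r + c = b * (c / b + of_nat r)"
      using assms by (simp add: field_simps)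
    then show "inverse (b ^ m) * inverse ((c / b + of_nat r) ^ m) = 1 / (b * real r + c) ^ m"
      by (simp only: power_mult_distrib inverse_mult_distrib divide_inverse mult_1)
  qed
  finally show ?thesis .
qed

lemma Polygamma_scaled_sums:
  fixes b z :: complex
  assumes "z \<noteq> 0" "j > 0"
  shows "(\<lambda>r. inverse (b * of_nat r + b * z) ^ (j + 1)) sums
           ((-1) ^ (j + 1) * Polygamma j z / (fact j * b ^ (j + 1)))"
proof -
  have "(\<lambda>r. inverse (b ^ (j + 1)) * inverse ((z + of_nat r) ^ Suc j)) sums
      (inverse (b ^ (j + 1)) * ((-1) ^ Suc j * Polygamma j z / fact j))"
    by (intro sums_mult Polygamma_LIMSEQ assms)
  also have "(\<lambda>r. inverse (b ^ (j + 1)) * inverse ((z + of_nat r) ^ Suc j)) =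
      (\<lambda>r. inverse (b * of_nat r + b * z) ^ (j + 1))"
    by (simp add: fun_eq_iff power_inverse[symmetric] distrib_left[symmetric] power_mult_distrib add.commute
        del: power_Suc)
  finally show ?thesis
    by (simp add: field_simps)
qed

text \<open>The two values of \<open>a\<close> are \<open>(2 * l + 1) * pi / 2\<close> for
  \<open>l = 2 * r\<close> and \<open>l = 2 * r + 1\<close>, so each term collects two consecutive
  pole pairs with signs \<open>(-1) ^ (j * l)\<close>.\<close>

definition Phi_term :: "nat \<Rightarrow> nat \<Rightarrow> real \<Rightarrow> complex" where
  "Phi_term j r t = - \<i> * (pole_kernel (j + 1) (2 * pi * real r + pi / 2) t
                          + (-1) ^ j * pole_kernel (j + 1) (2 * pi * real r + 3 * pi / 2) t)"

lemma of_real_in_strip [simp]: "of_real t \<in> strip"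
  by (simp add: strip_def)

text \<open>Each polygamma value in \<open>Phi\<close> is a series of inverse powers; scaling by
  \<open>b = 2 * pi\<close> turns its denominators into those of the pole kernels. At
  \<open>t = 0\<close> both sides are 0 by the convention for division.\<close>

lemma Phi_term_sums:
  assumes "j > 0"
  shows "(\<lambda>r. Phi_term j r t) sums (Phi j (of_real t) / of_real t)"
proof -
  define b where "b = 2 * complex_of_real pi"
  define w where "w = \<i> * of_real t / b"
  have b: "b \<noteq> 0" by (simp add: b_def)
  have bw: "b * w = \<i> * of_real t" using b by (simp add: w_def)
  have ne: "1/4 - w \<noteq> 0" "1/4 + w \<noteq> 0" "3/4 - w \<noteq> 0" "3/4 + w \<noteq> 0"
    using strip_quarter_arguments[of "of_real t", folded b_def w_def]
    by (metis of_real_in_strip zero_in_nonpos_Ints)+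
  define P where "P z = (-1) ^ (j + 1) * Polygamma j z / (fact j * b ^ (j + 1))" for z
  have P: "(\<lambda>r. inverse (b * of_nat r + b * z) ^ (j + 1)) sums P z" if "z \<noteq> 0" for z
    unfolding P_def by (rule Polygamma_scaled_sums[OF that assms])
  have "(\<lambda>r. - \<i> * (inverse (b * of_nat r + b * (1/4 - w)) ^ (j + 1)
              - inverse (b * of_nat r + b * (1/4 + w)) ^ (j + 1)
              + (-1) ^ j * (inverse (b * of_nat r + b * (3/4 - w)) ^ (j + 1)
              - inverse (b * of_nat r + b * (3/4 + w)) ^ (j + 1))) / of_real t) sums
      (- \<i> * (P (1/4 - w) - P (1/4 + w) + (-1) ^ j * (P (3/4 - w) - P (3/4 + w))) / of_real t)"
    by (intro sums_divide sums_mult sums_add sums_diff P ne)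
  moreover have "- \<i> * (P (1/4 - w) - P (1/4 + w) + (-1) ^ j * (P (3/4 - w) - P (3/4 + w))) =
      Phi j (of_real t)"
  proof -
    have "- \<i> * ((-1) ^ (j + 1) * x1 / (fact j * b ^ (j + 1)) - (-1) ^ (j + 1) * x2 / (fact j * b ^ (j + 1))
        + (-1) ^ j * ((-1) ^ (j + 1) * x3 / (fact j * b ^ (j + 1)) - (-1) ^ (j + 1) * x4 / (fact j * b ^ (j + 1)))) =
      \<i> * (-1) ^ j / (fact j * b ^ (j + 1)) * (x1 - x2 + (-1) ^ j * (x3 - x4))" for x1 x2 x3 x4
      by (simp add: divide_inverse algebra_simps)
    then show ?thesis
      unfolding P_def Phi_def b_def[symmetric] w_def[symmetric] .
  qed
  moreover have "- \<i> * (inverse (b * of_nat r + b * (1/4 - w)) ^ (j + 1)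
              - inverse (b * of_nat r + b * (1/4 + w)) ^ (j + 1)
              + (-1) ^ j * (inverse (b * of_nat r + b * (3/4 - w)) ^ (j + 1)
              - inverse (b * of_nat r + b * (3/4 + w)) ^ (j + 1))) / of_real t = Phi_term j r t" for r
  proof -
    have "b * of_nat r + b * (1/4 - w) = of_real (2 * pi * real r + pi / 2) - \<i> * of_real t"
      "b * of_nat r + b * (1/4 + w) = of_real (2 * pi * real r + pi / 2) + \<i> * of_real t"
      "b * of_nat r + b * (3/4 - w) = of_real (2 * pi * real r + 3 * pi / 2) - \<i> * of_real t"
      "b * of_nat r + b * (3/4 + w) = of_real (2 * pi * real r + 3 * pi / 2) + \<i> * of_real t"
      unfolding distrib_left right_diff_distrib bw by (simp_all add: b_def)
    moreover have "- \<i> * (x1 - x2 + e * (x3 - x4)) / y = - \<i> * ((x1 - x2) / y + e * ((x3 - x4) / y))"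
      for e x1 x2 x3 x4 y :: complex
      by (simp add: divide_inverse algebra_simps)
    ultimately show ?thesis
      unfolding Phi_term_def pole_kernel_def by (simp only:)
  qed
  ultimately show ?thesis by (simp only:)
qed

lemma set_integrable_suminf:
  fixes f :: "nat \<Rightarrow> 'b \<Rightarrow> 'a :: {banach, second_countable_topology}"
  assumes "\<And>i. set_integrable M A (f i)"
    and "\<And>x. x \<in> A \<Longrightarrow> summable (\<lambda>i. norm (f i x))"
    and "summable (\<lambda>i. LINT x:A|M. norm (f i x))"
  shows "set_integrable M A (\<lambda>x. \<Sum>i. f i x)"
    and "(\<lambda>i. LINT x:A|M. f i x) sums (LINT x:A|M. \<Sum>i. f i x)"
proof -
  let ?g = "\<lambda>i x. indicator A x *\<^sub>R f i x"
  have 1: "integrable M (?g i)" for i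
    using assms(1) unfolding set_integrable_def .
  have 2: "AE x in M. summable (\<lambda>i. norm (?g i x))"
    using assms(2) by (auto simp: indicator_def)
  have 3: "summable (\<lambda>i. LINT x|M. norm (?g i x))"
    using assms(3) unfolding set_lebesgue_integral_def by simp
  have eq: "(\<lambda>x. \<Sum>i. ?g i x) = (\<lambda>x. indicator A x *\<^sub>R (\<Sum>i. f i x))"
    by (auto simp: fun_eq_iff indicator_def)
  from integrable_suminf[OF 1 2 3] sums_integral[OF 1 2 3]
  show "set_integrable M A (\<lambda>x. \<Sum>i. f i x)"
    "(\<lambda>i. LINT x:A|M. f i x) sums (LINT x:A|M. \<Sum>i. f i x)"
    unfolding eq set_integrable_def set_lebesgue_integral_def by simp_all
qed

text \<open>The integrals of the norms of the terms are bounded by multiples of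
  \<open>a ^ - (j + 1)\<close>, summable because \<open>j > 0\<close>. This justifies termwise
  integration, and the factor \<open>- \<i>\<close> makes each pole pair contribute
  \<open>pi / a ^ (j + 1)\<close>.\<close>

lemma Phi_integral:
  assumes "j > 0"
  shows "set_integrable lborel {0<..} (\<lambda>t. Phi j (of_real t) / of_real t)"
    and "(\<lambda>r. of_real (pi / (2 * pi * real r + pi / 2) ^ (j + 1)
                 + (-1) ^ j * (pi / (2 * pi * real r + 3 * pi / 2) ^ (j + 1)))) sums
           (LBINT t:{0<..}. Phi j (of_real t) / of_real t)"
proof -
  define \<alpha> where "\<alpha> r = 2 * pi * real r + pi / 2" for r
  define \<beta> where "\<beta> r = 2 * pi * real r + 3 * pi / 2" for r
  have pos: "\<alpha> r > 0" "\<beta> r > 0" for r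
    by (auto simp: \<alpha>_def \<beta>_def intro!: add_nonneg_pos)
  have summable: "summable (\<lambda>r. 1 / \<alpha> r ^ (j + 1))" "summable (\<lambda>r. 1 / \<beta> r ^ (j + 1))"
    unfolding \<alpha>_def \<beta>_def using assms by (intro summable_inverse_power_arith; simp)+
  note ker = pole_kernel_integrable(1)[OF pos(1)] pole_kernel_integrable(1)[OF pos(2)]
  have Phi_term: "Phi_term j r = (\<lambda>t. - \<i> * pole_kernel (j + 1) (\<alpha> r) t
      + (- \<i> * (-1) ^ j) * pole_kernel (j + 1) (\<beta> r) t)" for r
    by (simp add: fun_eq_iff Phi_term_def \<alpha>_def \<beta>_def algebra_simps)
  have norm_le: "norm (Phi_term j r t)
      \<le> norm (pole_kernel (j + 1) (\<alpha> r) t) + norm (pole_kernel (j + 1) (\<beta> r) t)" for r t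
    unfolding Phi_term by (rule order_trans[OF norm_triangle_ineq]) (simp add: norm_mult norm_power)
  have int: "set_integrable lborel {0<..} (Phi_term j r)" for r
    unfolding Phi_term by (intro set_integral_add set_integrable_mult_right ker)
  have bound: "summable (\<lambda>r. C * (1 / \<alpha> r ^ (j + 1) + 1 / \<beta> r ^ (j + 1)))" for C
    by (intro summable_mult summable_add summable)
  have sum_norm: "summable (\<lambda>r. norm (Phi_term j r t))" if "t \<in> {0<..}" for t
  proof (rule summable_comparison_test)
    \<comment> \<open>For fixed \<open>t\<close>, the inequality
      \<open>2 * t * x \<le> x\<^sup>2 + t\<^sup>2\<close> turns the kernel bound into one that is
      summable over the poles \<open>x\<close>.\<close>
    have *: "norm (pole_kernel (j + 1) x t) \<le> real (j + 1) / t * (1 / x ^ (j + 1))" if x: "x > 0" for x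
    proof -
      have "2 * t * x \<le> x\<^sup>2 + t\<^sup>2"
        using sum_squares_bound[of x t] by (simp add: mult_ac)
      then have "2 * x * (1 / (x\<^sup>2 + t\<^sup>2)) \<le> 1 / t"
        using x \<open>t \<in> {0<..}\<close> by (simp add: field_simps add_pos_pos)
      then have "real (j + 1) / x ^ (j + 1) * (2 * x * (1 / (x\<^sup>2 + t\<^sup>2)))
          \<le> real (j + 1) / x ^ (j + 1) * (1 / t)"
        using x by (intro mult_left_mono) auto
      then show ?thesis
        using norm_pole_kernel_le[OF x, of t "j + 1"] \<open>t \<in> {0<..}\<close>
        by (simp add: mult_ac del: power_Suc of_nat_Suc)
    qed
    have "norm (norm (Phi_term j r t)) \<le>
        real (j + 1) / t * (1 / \<alpha> r ^ (j + 1) + 1 / \<beta> r ^ (j + 1))" for r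
      using norm_le[of r t] *[OF pos(1)[of r]] *[OF pos(2)[of r]]
      unfolding distrib_left real_norm_def abs_norm_cancel by linarith
    then show "\<exists>N. \<forall>r\<ge>N. norm (norm (Phi_term j r t)) \<le>
        real (j + 1) / t * (1 / \<alpha> r ^ (j + 1) + 1 / \<beta> r ^ (j + 1))"
      by blast
  qed (rule bound)
  have sum_int: "summable (\<lambda>r. LBINT t:{0<..}. norm (Phi_term j r t))"
  proof (rule summable_comparison_test)
    have "norm (LBINT t:{0<..}. norm (Phi_term j r t)) \<le>
        real (j + 1) * pi * (1 / \<alpha> r ^ (j + 1) + 1 / \<beta> r ^ (j + 1))" for r
    proof -
      have "norm (LBINT t:{0<..}. norm (Phi_term j r t)) = (LBINT t:{0<..}. norm (Phi_term j r t))"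
        by (simp add: set_lebesgue_integral_def integral_nonneg_AE)
      also have "\<dots> \<le> (LBINT t:{0<..}. norm (pole_kernel (j + 1) (\<alpha> r) t) + norm (pole_kernel (j + 1) (\<beta> r) t))"
        by (intro set_integral_mono set_integral_add set_integrable_norm int ker norm_le)
      also have "\<dots> = (LBINT t:{0<..}. norm (pole_kernel (j + 1) (\<alpha> r) t))
          + (LBINT t:{0<..}. norm (pole_kernel (j + 1) (\<beta> r) t))"
        by (intro set_integral_add set_integrable_norm ker)
      also have "\<dots> \<le> real (j + 1) * pi / \<alpha> r ^ (j + 1) + real (j + 1) * pi / \<beta> r ^ (j + 1)"
        by (intro add_mono pole_kernel_integrable(2) pos)
      finally show ?thesis by (simp add: algebra_simps del: power_Suc)
    qed
    then show "\<exists>N. \<forall>r\<ge>N. norm (LBINT t:{0<..}. norm (Phi_term j r t)) \<le>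
        real (j + 1) * pi * (1 / \<alpha> r ^ (j + 1) + 1 / \<beta> r ^ (j + 1))" by blast
  qed (rule bound)
  note set_integrable_suminf[OF int sum_norm sum_int]
  moreover have "(\<Sum>r. Phi_term j r t) = Phi j (of_real t) / of_real t" for t
    using Phi_term_sums[OF assms, of t] by (simp add: sums_iff)
  moreover have "(LBINT t:{0<..}. Phi_term j r t) =
      of_real (pi / \<alpha> r ^ (j + 1) + (-1) ^ j * (pi / \<beta> r ^ (j + 1)))" for r
  proof -
    have "(LBINT t:{0<..}. Phi_term j r t) = - \<i> * (\<i> * of_real (pi / \<alpha> r ^ (j + 1)))
        + (- \<i> * (-1) ^ j) * (\<i> * of_real (pi / \<beta> r ^ (j + 1)))"
      unfolding Phi_term
      by (subst set_integral_add)
         (auto simp only: set_integral_mult_right integral_pole_kernel[OF pos(1)] integral_pole_kernel[OF pos(2)]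
           intro!: set_integrable_mult_right ker)
    then show ?thesis by (simp add: algebra_simps)
  qed
  ultimately show "set_integrable lborel {0<..} (\<lambda>t. Phi j (of_real t) / of_real t)"
    "(\<lambda>r. of_real (pi / (2 * pi * real r + pi / 2) ^ (j + 1)
         + (-1) ^ j * (pi / (2 * pi * real r + 3 * pi / 2) ^ (j + 1)))) sums
       (LBINT t:{0<..}. Phi j (of_real t) / of_real t)"
    unfolding \<alpha>_def \<beta>_def by simp_all
qed

section \<open>Evaluation by zeta and beta values\<close>

lemma odd_power_sum_scaling:
  assumes "j > 0"
  shows "of_real (pi / (2 * pi * real r + pi / 2) ^ (j + 1)
           + (-1) ^ j * (pi / (2 * pi * real r + 3 * pi / 2) ^ (j + 1))) =
    2 ^ (j + 1) / complex_of_real pi ^ j *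
      (\<Sum>l\<in>{r * 2..<r * 2 + 2}. (-1) ^ (j * l) * inverse (of_nat (2 * l + 1) ^ (j + 1)))"
proof -
  \<comment> \<open>Every pole is \<open>pi / 2\<close> times an odd number; pulling out
    \<open>pi / 2\<close> leaves \<open>2 ^ (j + 1) / pi ^ j\<close>, where the numerator
    \<open>pi\<close> cancels one power.\<close>
  have a: "pi / ((pi / 2) * x) ^ (j + 1) = 2 ^ (j + 1) / pi ^ j * inverse (x ^ (j + 1))" for x
    by (simp add: power_mult_distrib power_divide field_simps)
  have "2 * pi * real r + pi / 2 = (pi / 2) * real (2 * (r * 2) + 1)"
    "2 * pi * real r + 3 * pi / 2 = (pi / 2) * real (2 * (Suc (r * 2)) + 1)"
    by (simp_all add: algebra_simps)
  moreover have "{r * 2..<r * 2 + 2} = {r * 2, Suc (r * 2)}" by auto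
  ultimately show ?thesis
    by (simp only: a) (simp add: power_mult[symmetric] power_add algebra_simps minus_one_power_iff)
qed

text \<open>The even integers contribute \<open>1 / 2 ^ m\<close> times the whole series.\<close>

lemma zeta_odd_part:
  assumes "m \<ge> 2"
  shows "(\<lambda>l. inverse (of_nat (2 * l + 1) ^ m)) sums ((1 - 1 / 2 ^ m) * zeta (of_nat m))"
proof -
  have powr_eq: "of_nat (Suc k) powr - of_nat m = inverse (of_nat (Suc k) ^ m :: complex)" for k
    by (simp add: powr_minus powr_nat del: of_nat_Suc)
  have "summable (\<lambda>k. inverse ((1 + of_nat k) ^ m) :: complex)"
    by (rule Polygamma_converges') (use assms in auto)
  then have "(\<lambda>k. inverse (of_nat (Suc k) ^ m)) sums zeta (of_nat m)"
    unfolding zeta_def powr_eq by (simp add: summable_sums add.commute)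
  note zeta = this
  \<comment> \<open>Pairing the indices \<open>2 * l\<close> and \<open>2 * l + 1\<close> puts the
    integers \<open>2 * l + 1\<close> and \<open>2 * (l + 1)\<close> together, so the even one can
    be subtracted termwise.\<close>
  from sums_group[OF zeta, of 2]
  have "(\<lambda>l. \<Sum>k\<in>{l * 2..<l * 2 + 2}. inverse (of_nat (Suc k) ^ m)) sums zeta (of_nat m)"
    by simp
  moreover have "(\<lambda>l. 1 / 2 ^ m * inverse (of_nat (Suc l) ^ m)) sums (1 / 2 ^ m * zeta (of_nat m))"
    by (intro sums_mult zeta)
  ultimately have "(\<lambda>l. (\<Sum>k\<in>{l * 2..<l * 2 + 2}. inverse (of_nat (Suc k) ^ m))
      - 1 / 2 ^ m * inverse (of_nat (Suc l) ^ m)) sums (zeta (of_nat m) - 1 / 2 ^ m * zeta (of_nat m))"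
    by (rule sums_diff)
  also have "(\<lambda>l. (\<Sum>k\<in>{l * 2..<l * 2 + 2}. inverse (of_nat (Suc k) ^ m))
      - 1 / 2 ^ m * inverse (of_nat (Suc l) ^ m)) = (\<lambda>l. inverse (of_nat (2 * l + 1) ^ m) :: complex)"
  proof
    fix l
    have "{l * 2..<l * 2 + 2} = {l * 2, Suc (l * 2)}" by auto
    moreover have "of_nat (Suc (Suc (l * 2))) = (2 * of_nat (Suc l) :: complex)" by simp
    ultimately show "(\<Sum>k\<in>{l * 2..<l * 2 + 2}. inverse (of_nat (Suc k) ^ m))
        - 1 / 2 ^ m * inverse (of_nat (Suc l) ^ m) = (inverse (of_nat (2 * l + 1) ^ m) :: complex)"
      by (simp add: power_mult_distrib divide_inverse mult.commute[of l] del: of_nat_Suc)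
  qed
  finally show ?thesis by (simp add: algebra_simps)
qed

lemma Phi_integral_even:
  assumes "p \<ge> 1"
  shows "(LBINT t:{0<..}. Phi (2 * p) (of_real t) / of_real t) =
           (2 ^ (2 * p + 1) - 1) * (zeta (of_nat (2 * p + 1)) / complex_of_real pi ^ (2 * p))"
proof -
  have j: "2 * p > 0" using assms by simp
  have scale: "2 ^ m / q * ((1 - 1 / 2 ^ m) * Z) = (2 ^ m - 1) * (Z / q)" for q Z :: complex and m
  proof -
    have "2 ^ m * (1 - 1 / 2 ^ m) = (2 ^ m - 1 :: complex)"
      by (simp add: right_diff_distrib)
    moreover have "2 ^ m / q * ((1 - 1 / 2 ^ m) * Z) = 2 ^ m * (1 - 1 / 2 ^ m) * (Z / q)"
      by (simp only: times_divide_eq_left times_divide_eq_right mult.assoc)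
    ultimately show ?thesis by simp
  qed
  have "(\<lambda>l. (-1) ^ (2 * p * l) * inverse (of_nat (2 * l + 1) ^ (2 * p + 1))) sums
      ((1 - 1 / 2 ^ (2 * p + 1)) * zeta (of_nat (2 * p + 1)))"
    using zeta_odd_part[of "2 * p + 1"] assms by (simp add: power_mult)
  \<comment> \<open>Blocks of two consecutive odd integers match the pairing of the poles in
    \<open>Phi_term\<close>.\<close>
  from sums_mult[OF sums_group[OF this, of 2], of "2 ^ (2 * p + 1) / complex_of_real pi ^ (2 * p)"]
  have "(\<lambda>r. of_real (pi / (2 * pi * real r + pi / 2) ^ (2 * p + 1)
                 + (-1) ^ (2 * p) * (pi / (2 * pi * real r + 3 * pi / 2) ^ (2 * p + 1)))) sums
      ((2 ^ (2 * p + 1) - 1) * (zeta (of_nat (2 * p + 1)) / complex_of_real pi ^ (2 * p)))"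
    unfolding odd_power_sum_scaling[OF j] scale by simp
  with Phi_integral(2)[OF j] show ?thesis
    by (rule sums_unique2)
qed

text \<open>For odd \<open>j\<close> the sign \<open>(-1) ^ (j * l)\<close> is
  \<open>(-1) ^ l\<close>, which makes the series over odd integers the beta series.\<close>

lemma Phi_integral_odd:
  assumes "p \<ge> 1"
  shows "(LBINT t:{0<..}. Phi (2 * p - 1) (of_real t) / of_real t) =
           2 ^ (2 * p) * (dirichlet_beta (of_nat (2 * p)) / complex_of_real pi ^ (2 * p - 1))"
proof -
  define j where "j = 2 * p - 1"
  have j: "j > 0" "odd j" "j + 1 = 2 * p" using assms by (auto simp: j_def)
  have powr_eq: "(-1) ^ r * of_nat (2 * r + 1) powr - of_nat (j + 1) =
      ((-1) ^ (j * r) * inverse (of_nat (2 * r + 1) ^ (j + 1)) :: complex)" for r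
    using j(2) by (simp add: powr_minus powr_nat power_mult del: of_nat_Suc of_nat_add of_nat_mult power_Suc)
  have "summable (\<lambda>r. norm ((-1) ^ (j * r) * inverse (of_nat (2 * r + 1) ^ (j + 1)) :: complex))"
    using summable_inverse_power_arith[of 2 1 "j + 1"] j(1)
    by (simp add: norm_mult norm_power norm_inverse inverse_eq_divide norm_divide del: power_Suc of_nat_add of_nat_mult of_nat_Suc)
       (simp add: add.commute)
  then have "(\<lambda>r. (-1) ^ (j * r) * inverse (of_nat (2 * r + 1) ^ (j + 1))) sums dirichlet_beta (of_nat (j + 1))"
    unfolding dirichlet_beta_def powr_eq by (intro summable_sums) (rule summable_norm_cancel)
  from sums_mult[OF sums_group[OF this, of 2], of "2 ^ (j + 1) / complex_of_real pi ^ j"]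
  have "(\<lambda>r. of_real (pi / (2 * pi * real r + pi / 2) ^ (j + 1)
                 + (-1) ^ j * (pi / (2 * pi * real r + 3 * pi / 2) ^ (j + 1)))) sums
      (2 ^ (j + 1) * (dirichlet_beta (of_nat (j + 1)) / complex_of_real pi ^ j))"
    unfolding odd_power_sum_scaling[OF j(1)] by (simp del: power_Suc)
  with Phi_integral(2)[OF j(1)]
  have "(LBINT t:{0<..}. Phi j (of_real t) / of_real t) =
      2 ^ (j + 1) * (dirichlet_beta (of_nat (j + 1)) / complex_of_real pi ^ j)"
    by (rule sums_unique2)
  then show ?thesis
    unfolding j(3) by (simp add: j_def)
qed

section \<open>The substitution by the hyperbolic tangent\<close>

lemma tanh_image: "tanh ` {0<..} = {0<..<1 :: real}"
proof
  show "tanh ` {0<..} \<subseteq> {0<..<1 :: real}"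
    by (auto simp: tanh_real_lt_1)
  show "{0<..<1 :: real} \<subseteq> tanh ` {0<..}"
  proof
    fix x :: real assume x: "x \<in> {0<..<1}"
    \<comment> \<open>This is \<open>exp (2 * artanh x)\<close>, so \<open>tanh\<close> of its half
      logarithm is \<open>(y - 1) / (y + 1)\<close>.\<close>
    define y where "y = (1 + x) / (1 - x)"
    have "y > 0"
      using x by (simp add: y_def)
    then have "tanh (artanh x) = (y - 1) / (y + 1)"
      using tanh_ln_real[of "sqrt y"] by (simp add: artanh_def y_def[symmetric] ln_sqrt)
    also have "\<dots> = x"
      using x by (simp add: y_def field_simps)
    finally have "tanh (artanh x) = x" .
    moreover from this have "artanh x > 0"
      using x by (metis greaterThanLessThan_iff tanh_real_pos_iff)
    ultimately show "x \<in> tanh ` {0<..}"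
      by (metis greaterThan_iff imageI)
  qed
qed

text \<open>The derivative \<open>1 - tanh\<^sup>2\<close> is nonnegative, so no sign enters the
  change of variables. Integrability is assumed on the \<open>t\<close> side and carried over to
  \<open>f\<close>, including its behaviour near 0 and 1.\<close>

lemma tanh_substitution:
  fixes f :: "real \<Rightarrow> 'a :: euclidean_space"
  assumes "set_integrable lborel {0<..} g"
    and "\<And>t. t > 0 \<Longrightarrow> g t = (1 - (tanh t)\<^sup>2) *\<^sub>R f (tanh t)"
  shows "(f has_integral (LBINT t:{0<..}. g t)) {0<..<1}"
proof -
  have pos: "1 - (tanh t)\<^sup>2 \<ge> 0" for t :: real
    using tanh_real_lt_1[of t] tanh_real_gt_neg1[of t] abs_square_less_1[of "tanh t"]
    by (simp add: abs_less_iff)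
  \<comment> \<open>The change of variables is formulated for Lebesgue measure, so integrability
    passes from Borel measure to its completion.\<close>
  have g: "g absolutely_integrable_on {0<..}"
    using assms(1) unfolding set_integrable_def
    by (rule integrable_completion[THEN iffD2, rotated]) (use borel_measurable_integrable assms(1) in \<open>auto simp: set_integrable_def\<close>)
  have eq: "g t = \<bar>1 - (tanh t)\<^sup>2\<bar> *\<^sub>R f (tanh t)" if "t \<in> {0<..}" for t
    using assms(2)[of t] that pos[of t] by simp
  have "(\<lambda>t. \<bar>1 - (tanh t)\<^sup>2\<bar> *\<^sub>R f (tanh t)) absolutely_integrable_on {0<..}"
    using g by (rule set_integrable_cong[THEN iffD1, rotated -1]) (auto simp: eq)
  moreover have "integral {0<..} (\<lambda>t. \<bar>1 - (tanh t)\<^sup>2\<bar> *\<^sub>R f (tanh t)) = (LBINT t:{0<..}. g t)"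
    unfolding set_borel_integral_eq_integral(2)[OF assms(1)]
    by (rule Henstock_Kurzweil_Integration.integral_cong) (simp add: eq)
  ultimately have "f absolutely_integrable_on tanh ` {0<..} \<and>
      integral (tanh ` {0<..}) f = (LBINT t:{0<..}. g t)"
    by (subst has_absolute_integral_change_of_variables_real[symmetric, where h = "\<lambda>t. 1 - (tanh t)\<^sup>2"])
       (auto intro!: derivative_eq_intros inj_onI)
  then show ?thesis
    unfolding tanh_image by (metis absolutely_integrable_on_def has_integral_integral)
qed

lemma Phi_combination:
  assumes "s \<in> {1, 2}" "z \<in> strip"
  shows "(\<Sum>p = 1..N + 1. (\<Sum>m\<le>N. of_nat (N choose m) * (-1) ^ m * arcsin_coeff (2 * p + s - 2) (2 * m + s))
             * Phi (2 * p + s - 2) z) =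
         tanh z ^ (2 * N + 1) * inverse (cosh z) ^ s"
proof -
  have expand: "(\<Sum>p = 1..N + 1. arcsin_coeff (2 * p + s - 2) (2 * m + s) * Phi (2 * p + s - 2) z) =
      tanh z * inverse (cosh z) ^ (2 * m + s)" if "m \<le> N" for m
  proof -
    have "(\<Sum>p = 1..N + 1. arcsin_coeff (2 * p + s - 2) (2 * m + s) * Phi (2 * p + s - 2) z) =
        (\<Sum>p = 1..m + 1. arcsin_coeff (2 * p + s - 2) (2 * m + s) * Phi (2 * p + s - 2) z)"
      using that assms(1) by (intro sum.mono_neutral_right) (auto intro!: arcsin_coeff_eq_0)
    also have "\<dots> = tanh z * inverse (cosh z) ^ (2 * m + s)"
    proof (cases "s = 1")
      case True
      have "(\<Sum>p = 1..m + 1. arcsin_coeff (2 * p + s - 2) (2 * m + s) * Phi (2 * p + s - 2) z) =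
          (\<Sum>p\<le>m. arcsin_coeff (2 * p + 1) (2 * m + 1) * Phi (2 * p + 1) z)"
        by (rule sum.reindex_bij_witness[of _ Suc "\<lambda>p. p - 1"]) (auto simp: True Suc_le_eq gr0_conv_Suc)
      then show ?thesis
        using tanh_sech_power_expansion[of 1 z m] assms(2) True by simp
    next
      case False
      then have s: "s = 2" using assms(1) by simp
      \<comment> \<open>The term \<open>p = 0\<close> can be added: its coefficient is that of a
        positive power of \<open>z\<close> in the constant series 1.\<close>
      have "(\<Sum>p = 1..m + 1. arcsin_coeff (2 * p + s - 2) (2 * m + s) * Phi (2 * p + s - 2) z) =
          (\<Sum>p\<le>m + 1. arcsin_coeff (2 * p + 0) (2 * (m + 1) + 0) * Phi (2 * p + 0) z)"
        by (rule sum.mono_neutral_cong_left) (auto simp: s arcsin_coeff_0 Suc_le_eq)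
      also have "\<dots> = tanh z * inverse (cosh z) ^ (2 * (m + 1) + 0)"
        by (rule tanh_sech_power_expansion[symmetric]) (use assms(2) in auto)
      finally show ?thesis by (simp add: s)
    qed
    finally show ?thesis .
  qed
  have "(\<Sum>p = 1..N + 1. (\<Sum>m\<le>N. of_nat (N choose m) * (-1) ^ m * arcsin_coeff (2 * p + s - 2) (2 * m + s))
             * Phi (2 * p + s - 2) z) =
      (\<Sum>m\<le>N. of_nat (N choose m) * (-1) ^ m *
         (\<Sum>p = 1..N + 1. arcsin_coeff (2 * p + s - 2) (2 * m + s) * Phi (2 * p + s - 2) z))"
    unfolding sum_distrib_right sum_distrib_left by (subst sum.swap) (simp only: mult.assoc)
  also have "\<dots> = (\<Sum>m\<le>N. of_nat (N choose m) * (-1) ^ m * (tanh z * inverse (cosh z) ^ (2 * m + s)))"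
    by (intro sum.cong refl arg_cong[of _ _ "(*) _"] expand) auto
  also have "\<dots> = tanh z * inverse (cosh z) ^ s *
      (\<Sum>m\<le>N. of_nat (N choose m) * (- (inverse (cosh z))\<^sup>2) ^ m * 1 ^ (N - m))"
    unfolding sum_distrib_left
    by (intro sum.cong refl) (simp add: power_minus[of "_\<^sup>2"] power_add power_mult[symmetric] mult_ac)
  also have "\<dots> = tanh z * inverse (cosh z) ^ s * (tanh z)\<^sup>2 ^ N"
    unfolding binomial_ring[symmetric] tanh_square_strip[OF assms(2)] by simp
  finally show ?thesis
    by (simp add: power_mult[symmetric] mult_ac)
qed

lemma of_real_sinh: "of_real (sinh x) = (sinh (of_real x) :: 'a :: {real_normed_field, banach})"
  by (simp add: sinh_def exp_of_real scaleR_conv_of_real flip: of_real_minus)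

lemma of_real_cosh: "of_real (cosh x) = (cosh (of_real x) :: 'a :: {real_normed_field, banach})"
  by (simp add: cosh_def exp_of_real scaleR_conv_of_real flip: of_real_minus)

lemma tanh_sech_integral:
  assumes "s \<in> {1, 2}"
  shows "set_integrable lborel {0<..}
           (\<lambda>t. complex_of_real (tanh t ^ (2 * N + 1) * inverse (cosh t) ^ s / t))"
    and "(LBINT t:{0<..}. complex_of_real (tanh t ^ (2 * N + 1) * inverse (cosh t) ^ s / t)) =
           (\<Sum>p = 1..N + 1. (\<Sum>m\<le>N. of_nat (N choose m) * (-1) ^ m * arcsin_coeff (2 * p + s - 2) (2 * m + s))
             * (LBINT t:{0<..}. Phi (2 * p + s - 2) (of_real t) / of_real t))"
proof -
  define c where "c p = (\<Sum>m\<le>N. of_nat (N choose m) * (-1) ^ m * arcsin_coeff (2 * p + s - 2) (2 * m + s))" for p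
  define f where "f p t = Phi (2 * p + s - 2) (of_real t) / of_real t" for p and t :: real
  have eq: "complex_of_real (tanh t ^ (2 * N + 1) * inverse (cosh t) ^ s / t) = (\<Sum>p = 1..N + 1. c p * f p t)" for t
    using Phi_combination[OF assms of_real_in_strip, of N t]
    by (simp add: c_def f_def sum_divide_distrib[symmetric] tanh_def of_real_sinh of_real_cosh del: sum.cl_ivl_Suc)
  \<comment> \<open>All orders \<open>2 * p + s - 2\<close> are positive, so
    \<open>Phi_integral\<close> applies; order 0 would be \<open>tanh t / t\<close>, which is not
    integrable at infinity.\<close>
  have int: "integrable lborel (\<lambda>t. c p * (indicator {0<..} t *\<^sub>R f p t))" if "p \<in> {1..N + 1}" for p
    using Phi_integral(1)[of "2 * p + s - 2"] that assms
    unfolding f_def set_integrable_def by (intro integrable_mult_right) auto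
  have ind: "indicator {0<..} t *\<^sub>R (\<Sum>p = 1..N + 1. c p * f p t) =
      (\<Sum>p = 1..N + 1. c p * (indicator {0<..} t *\<^sub>R f p t))" for t
    unfolding scaleR_sum_right by simp
  show "set_integrable lborel {0<..}
      (\<lambda>t. complex_of_real (tanh t ^ (2 * N + 1) * inverse (cosh t) ^ s / t))"
    unfolding eq set_integrable_def ind by (intro Bochner_Integration.integrable_sum int)
  have "(LBINT t:{0<..}. complex_of_real (tanh t ^ (2 * N + 1) * inverse (cosh t) ^ s / t)) =
      (\<Sum>p = 1..N + 1. c p * (LBINT t:{0<..}. f p t))"
    unfolding eq set_lebesgue_integral_def ind
    by (subst Bochner_Integration.integral_sum, erule int) (simp only: integral_mult_right_zero)
  then show "(LBINT t:{0<..}. complex_of_real (tanh t ^ (2 * N + 1) * inverse (cosh t) ^ s / t)) =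
           (\<Sum>p = 1..N + 1. (\<Sum>m\<le>N. of_nat (N choose m) * (-1) ^ m * arcsin_coeff (2 * p + s - 2) (2 * m + s))
             * (LBINT t:{0<..}. Phi (2 * p + s - 2) (of_real t) / of_real t))"
    unfolding c_def f_def .
qed

theorem corollary1p4:
  fixes n :: nat
  assumes "n \<ge> 1"
  shows "((\<lambda>x::real. complex_of_real (x ^ (2 * n - 1) / artanh x)) has_integral
           (\<Sum>p = 1..n. (2 ^ (2 * p + 1) - 1)
              * fps_nth (fps_expansion (\<lambda>z. (z\<^sup>2 - 1) ^ (n - 1) * Arcsin z ^ (2 * p)) 0) (2 * n)
              * (zeta (of_nat (2 * p + 1)) / complex_of_real pi ^ (2 * p)))) {0<..<1}
       \<and> ((\<lambda>x::real. complex_of_real (x ^ (2 * n - 1) / (sqrt (1 - x\<^sup>2) * artanh x))) has_integral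
           (\<Sum>p = 1..n. 2 ^ (2 * p)
              * fps_nth (fps_expansion (\<lambda>z. (z\<^sup>2 - 1) ^ (n - 1) * Arcsin z ^ (2 * p - 1)) 0) (2 * n - 1)
              * (dirichlet_beta (of_nat (2 * p)) / complex_of_real pi ^ (2 * p - 1)))) {0<..<1}"
proof
  define N where "N = n - 1"
  have n: "n = N + 1" "2 * n - 1 = 2 * N + 1" using assms by (simp_all add: N_def)
  have sech: "1 - (tanh t)\<^sup>2 = (inverse (cosh t))\<^sup>2" for t :: real
  proof -
    have "(sinh t)\<^sup>2 = (cosh t)\<^sup>2 - 1"
      by (simp add: cosh_square_eq)
    then show ?thesis
      by (simp add: tanh_def power_divide power_inverse inverse_eq_divide diff_divide_distrib)
  qed
  have sqrt_sech: "sqrt (1 - (tanh t)\<^sup>2) = inverse (cosh t)" for t :: real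
    unfolding sech by (intro real_sqrt_unique refl) simp
  have "2 \<in> {1, 2 :: nat}" "1 \<in> {1, 2 :: nat}" by simp_all
  note int = tanh_sech_integral[OF this(1), of N] tanh_sech_integral[OF this(2), of N]
  \<comment> \<open>Since \<open>2 * n = 2 * N + 2\<close> and \<open>2 * n - 1 = 2 * N + 1\<close>,
    the two cases are \<open>s = 2\<close> and \<open>s = 1\<close>.\<close>
  have coeff: "fps_nth (fps_expansion (\<lambda>z. (z\<^sup>2 - 1) ^ (n - 1) * Arcsin z ^ j) 0) (2 * n) =
      (\<Sum>m\<le>N. of_nat (N choose m) * (-1) ^ m * arcsin_coeff j (2 * m + 2))"
    "fps_nth (fps_expansion (\<lambda>z. (z\<^sup>2 - 1) ^ (n - 1) * Arcsin z ^ j) 0) (2 * n - 1) =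
      (\<Sum>m\<le>N. of_nat (N choose m) * (-1) ^ m * arcsin_coeff j (2 * m + 1))" for j
    unfolding N_def[symmetric]
    by (rule fps_nth_expansion_X2_minus_1_power_Arcsin_power; use n in simp)+
  have "(LBINT t:{0<..}. complex_of_real (tanh t ^ (2 * N + 1) * inverse (cosh t) ^ 2 / t)) =
      (\<Sum>p = 1..n. (2 ^ (2 * p + 1) - 1)
              * fps_nth (fps_expansion (\<lambda>z. (z\<^sup>2 - 1) ^ (n - 1) * Arcsin z ^ (2 * p)) 0) (2 * n)
              * (zeta (of_nat (2 * p + 1)) / complex_of_real pi ^ (2 * p)))"
    unfolding int(2) n(1)[symmetric] coeff
    by (intro sum.cong refl)
       (simp add: Phi_integral_even)
  \<comment> \<open>Substituting \<open>x = tanh t\<close> turns \<open>artanh x\<close> into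
    \<open>t\<close>, and the Jacobian \<open>sech\<^sup>2\<close> accounts for
    \<open>s = 2\<close>.\<close>
  moreover have "((\<lambda>x::real. complex_of_real (x ^ (2 * n - 1) / artanh x)) has_integral
      (LBINT t:{0<..}. complex_of_real (tanh t ^ (2 * N + 1) * inverse (cosh t) ^ 2 / t))) {0<..<1}"
    by (intro tanh_substitution int) (simp_all add: sech artanh_tanh_real n scaleR_conv_of_real mult_ac)
  ultimately show "((\<lambda>x::real. complex_of_real (x ^ (2 * n - 1) / artanh x)) has_integral
           (\<Sum>p = 1..n. (2 ^ (2 * p + 1) - 1)
              * fps_nth (fps_expansion (\<lambda>z. (z\<^sup>2 - 1) ^ (n - 1) * Arcsin z ^ (2 * p)) 0) (2 * n)
              * (zeta (of_nat (2 * p + 1)) / complex_of_real pi ^ (2 * p)))) {0<..<1}"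
    by (simp only:)
  have "(LBINT t:{0<..}. complex_of_real (tanh t ^ (2 * N + 1) * inverse (cosh t) ^ 1 / t)) =
      (\<Sum>p = 1..n. 2 ^ (2 * p)
              * fps_nth (fps_expansion (\<lambda>z. (z\<^sup>2 - 1) ^ (n - 1) * Arcsin z ^ (2 * p - 1)) 0) (2 * n - 1)
              * (dirichlet_beta (of_nat (2 * p)) / complex_of_real pi ^ (2 * p - 1)))"
    unfolding int(4) n(1)[symmetric] coeff
    by (intro sum.cong refl)
       (simp add: Phi_integral_odd[unfolded One_nat_def])
  moreover have "((\<lambda>x::real. complex_of_real (x ^ (2 * n - 1) / (sqrt (1 - x\<^sup>2) * artanh x))) has_integral
      (LBINT t:{0<..}. complex_of_real (tanh t ^ (2 * N + 1) * inverse (cosh t) ^ 1 / t))) {0<..<1}"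
  proof (intro tanh_substitution int)
    fix t :: real
    \<comment> \<open>The square root equals \<open>sech t\<close> and cancels one of the two
      factors of the Jacobian, leaving \<open>s = 1\<close>.\<close>
    have "tanh t ^ (2 * N + 1) * inverse (cosh t) ^ 1 / t =
        (inverse (cosh t))\<^sup>2 * (tanh t ^ (2 * N + 1) / (inverse (cosh t) * t))"
      by (simp add: power2_eq_square)
    then show "complex_of_real (tanh t ^ (2 * N + 1) * inverse (cosh t) ^ 1 / t) =
        (1 - (tanh t)\<^sup>2) *\<^sub>R complex_of_real (tanh t ^ (2 * n - 1) / (sqrt (1 - (tanh t)\<^sup>2) * artanh (tanh t)))"
      unfolding sqrt_sech artanh_tanh_real n(2) scaleR_conv_of_real of_real_mult[symmetric] unfolding sech
      by (rule arg_cong)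
  qed
  ultimately show "((\<lambda>x::real. complex_of_real (x ^ (2 * n - 1) / (sqrt (1 - x\<^sup>2) * artanh x))) has_integral
           (\<Sum>p = 1..n. 2 ^ (2 * p)
              * fps_nth (fps_expansion (\<lambda>z. (z\<^sup>2 - 1) ^ (n - 1) * Arcsin z ^ (2 * p - 1)) 0) (2 * n - 1)
              * (dirichlet_beta (of_nat (2 * p)) / complex_of_real pi ^ (2 * p - 1)))) {0<..<1}"
    by (simp only:)
qed

end
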